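(* Let $L,M\in\mathbf{C}(x)[\partial]$ be commuting differential operators of orders $n,m>0$, and assume $L,M$ is a true rank $r$ pair. Let $\Gamma$ be the spectral curve of $L,M$. Then for every non-singular point $(\lambda_0,\mu_0)$ of $\Gamma$, the subresultants $\mathcal{L}_k(L-\lambda_0,M-\mu_0)$ vanish identically for $k=0,\dots,r-1$, and $\mathcal{L}_r(L-\lambda_0,M-\mu_0)$ is a differential operator of order $r$ which is a greatest common right divisor of $L-\lambda_0$ and $M-\mu_0$ in $\mathbf{C}(x)[\partial]$ (greatest common right divisors being unique up to left multiplication by a nonzero element of $\mathbf{C}(x)$).
   Context: $\mathbf{C}(x)[\partial]$ is the ring of differential operators with coefficients in $\mathbf{C}(x)$, $\partial=d/dx$, $\partial a=a\partial+a'$. For operators $P,Q$ of orders $n,m$ and $k=0,\dots,\min\{n,m\}-1$, let $S_k(P,Q)$ be the $(n+m-2k)\times(n+m-k)$ coefficient matrix of the operators $\partial^{m-1-k}P,\dots,\partial P,P,\partial^{n-1-k}Q,\dots,\partial Q,Q$ with respect to the monomials $\partial^{n+m-1-k},\dots,\partial,1$. For $i=0,\dots,k$ let $S_k^i$ be the square matrix obtained from $S_k$ by deleting the columns indexed by $\partial^k,\dots,\partial,1$ except the column indexed by $\partial^i$. The $k$-th differential subresultant is $\mathcal{L}_k(P,Q)=\sum_{i=0}^k\det(S_k^i)\partial^i$; the differential resultant is $\partial\mathrm{Res}(P,Q)=\det S_0(P,Q)$. For commuting $L,M$, $f(\lambda,\mu)=\partial\mathrm{Res}(L-\lambda,M-\mu)\in\mathbf{C}[\lambda,\mu]$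 and $f=h^{s}$ with $h$ irreducible, $s$ the rank of the algebra $\mathbf{C}[L,M]$; the spectral curve $\Gamma$ is the plane curve $h=0$. The rank of a set of operators is the gcd of the orders of its elements. $L,M$ is a true rank $r$ pair if $r=\gcd(\mathrm{ord}\,L,\mathrm{ord}\,M)$ equals the rank of the algebra $\mathbf{C}[L,M]$.
   Formalization: The claim on L_r is made only for r < min(n,m), since L_k is defined only for k < min(n,m) (e.g. L=M=∂ has no L_1); Γ is given by an irreducible h with f = h^s for some s, f free of x (fails for (x∂)^2,(x∂)^3); uniqueness of the gcrd is not restated. *)

theory Defs
  imports "HOL-Computational_Algebra.Polynomial"
          "HOL-Computational_Algebra.Fraction_Field"
          "HOL-Computational_Algebra.Factorial_Ring"
          "Jordan_Normal_Form.Determinant"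
begin

type_synonym rf = "complex poly fract"

definition rf_deriv :: "rf \<Rightarrow> rf" where
  "rf_deriv z = (let pq = (SOME pq. snd pq \<noteq> 0 \<and> z = Fract (fst pq) (snd pq))
                 in Fract (pderiv (fst pq) * snd pq - fst pq * pderiv (snd pq)) (snd pq * snd pq))"

definition cst :: "complex \<Rightarrow> rf" where
  "cst c = to_fract [:c:]"

text \<open>An operator sum a_i d^i is represented by the polynomial with coefficients a_i;
  addition is polynomial addition, the order is the degree, and the (non-commutative)
  product is defined using d^i b = sum_j (i choose j) b^(j) d^(i-j).\<close>
type_synonym dop = "rf poly"

definition dmult :: "dop \<Rightarrow> dop \<Rightarrow> dop" where
  "dmult A B = (\<Sum>i\<le>degree A. \<Sum>k\<le>degree B. \<Sum>j\<le>i.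
      monom (coeff A i * of_nat (i choose j) * (rf_deriv ^^ j) (coeff B k)) (i - j + k))"

definition dord :: "dop \<Rightarrow> nat" where
  "dord P = degree P"

definition dpow_mult :: "nat \<Rightarrow> dop \<Rightarrow> dop" where
  "dpow_mult j P = dmult (monom 1 j) P"

definition dshift :: "dop \<Rightarrow> complex \<Rightarrow> dop" where
  "dshift P c = P - [:cst c:]"

definition sres_row :: "dop \<Rightarrow> dop \<Rightarrow> nat \<Rightarrow> nat \<Rightarrow> dop" where
  "sres_row P Q k a =
     (let n = dord P; m = dord Q in
      if a < m - k then dpow_mult (m - 1 - k - a) P
      else dpow_mult (n - 1 - k - (a - (m - k))) Q)"

definition sres_mat :: "dop \<Rightarrow> dop \<Rightarrow> nat \<Rightarrow> rf mat" where
  "sres_mat P Q k =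
     (let n = dord P; m = dord Q in
      mat (n + m - 2*k) (n + m - k)
        (\<lambda>(a, c). coeff (sres_row P Q k a) (n + m - 1 - k - c)))"

text \<open>S_k^i: delete the columns d^k, ..., d, 1 except d^i (kept as last column).\<close>
definition sres_mat_i :: "dop \<Rightarrow> dop \<Rightarrow> nat \<Rightarrow> nat \<Rightarrow> rf mat" where
  "sres_mat_i P Q k i =
     (let n = dord P; m = dord Q in
      mat (n + m - 2*k) (n + m - 2*k)
        (\<lambda>(a, c). if c < n + m - 1 - 2*k
                   then coeff (sres_row P Q k a) (n + m - 1 - k - c)
                   else coeff (sres_row P Q k a) i))"

definition dsubres :: "dop \<Rightarrow> dop \<Rightarrow> nat \<Rightarrow> dop" where
  "dsubres P Q k = (\<Sum>i\<le>k. monom (det (sres_mat_i P Q k i)) i)"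

definition dres :: "dop \<Rightarrow> dop \<Rightarrow> rf" where
  "dres P Q = det (sres_mat P Q 0)"

inductive_set dalg :: "dop \<Rightarrow> dop \<Rightarrow> dop set" for L M where
  const: "[:cst c:] \<in> dalg L M"
| genL: "L \<in> dalg L M"
| genM: "M \<in> dalg L M"
| add: "A \<in> dalg L M \<Longrightarrow> B \<in> dalg L M \<Longrightarrow> A + B \<in> dalg L M"
| mult: "A \<in> dalg L M \<Longrightarrow> B \<in> dalg L M \<Longrightarrow> dmult A B \<in> dalg L M"

definition op_rank :: "dop set \<Rightarrow> nat" where
  "op_rank S = Gcd (dord ` (S - {0}))"

definition true_rank_pair :: "dop \<Rightarrow> dop \<Rightarrow> nat \<Rightarrow> bool" where
  "true_rank_pair L M r \<longleftrightarrow> r = gcd (dord L) (dord M) \<and> r = op_rank (dalg L M)"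

definition rdvd :: "dop \<Rightarrow> dop \<Rightarrow> bool" where
  "rdvd D A \<longleftrightarrow> (\<exists>Q. A = dmult Q D)"

definition is_gcrd :: "dop \<Rightarrow> dop \<Rightarrow> dop \<Rightarrow> bool" where
  "is_gcrd D A B \<longleftrightarrow> rdvd D A \<and> rdvd D B \<and> (\<forall>E. rdvd E A \<and> rdvd E B \<longrightarrow> rdvd E D)"

text \<open>h is a polynomial in mu whose coefficients are polynomials in lambda.\<close>
definition eval2 :: "complex poly poly \<Rightarrow> complex \<Rightarrow> complex \<Rightarrow> complex" where
  "eval2 h lam mu = poly (map_poly (\<lambda>p. poly p lam) h) mu"

definition dlam :: "complex poly poly \<Rightarrow> complex poly poly" where
  "dlam h = map_poly pderiv h"

definition dmu :: "complex poly poly \<Rightarrow> complex poly poly" where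
  "dmu h = pderiv h"

definition nonsingular_point :: "complex poly poly \<Rightarrow> complex \<Rightarrow> complex \<Rightarrow> bool" where
  "nonsingular_point h lam mu \<longleftrightarrow>
     eval2 h lam mu = 0 \<and> (eval2 (dlam h) lam mu \<noteq> 0 \<or> eval2 (dmu h) lam mu \<noteq> 0)"

text \<open>h defines the spectral curve of L,M: h irreducible and
  f(lambda,mu) = dRes(L - lambda, M - mu) equals h^s (as polynomial functions).\<close>
definition spectral_poly :: "dop \<Rightarrow> dop \<Rightarrow> complex poly poly \<Rightarrow> bool" where
  "spectral_poly L M h \<longleftrightarrow> irreducible h \<and>
     (\<exists>s. \<forall>lam mu. dres (dshift L lam) (dshift M mu) = cst (eval2 h lam mu ^ s))"

end

theory Submission
  imports Defs
    "Jordan_Normal_Form.Char_Poly"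
    "HOL-Computational_Algebra.Fundamental_Theorem_Algebra"
    "HOL-Computational_Algebra.Field_as_Ring"
begin

text \<open>
  Write \<open>f = h\<^sup>s\<close> for the resultant. For fixed \<open>x\<close>, up to a unit, \<open>f(x, \<cdot>)\<close> is the characteristic
  polynomial of right multiplication by \<open>M\<close> on the \<open>n\<close>-dimensional space of operators modulo left
  multiples of \<open>L - x\<close>; in particular \<open>s \<cdot> deg h(x, \<cdot>) = n\<close>. For every \<open>x\<close> some root \<open>y\<close> of \<open>h(x, \<cdot>)\<close>
  gives \<open>L - x\<close> and \<open>M - y\<close> a common right factor, which also divides \<open>h(L, M)\<close>; this is too many
  factors unless \<open>h(L, M) = 0\<close>. So at a point where \<open>\<partial>h/\<partial>y \<noteq> 0\<close> the eigenvalue \<open>y\<close> is semisimple, and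
  the order of the greatest common right divisor, i.e. the dimension of the cokernel of \<open>M - y\<close>, is
  the multiplicity \<open>s\<close> of \<open>y\<close> as a root of \<open>f(x, \<cdot>)\<close>. The case \<open>\<partial>h/\<partial>x \<noteq> 0\<close> follows by exchanging
  \<open>L\<close> and \<open>M\<close>. Degrees give \<open>s | gcd(n, m) = r\<close>; conversely \<open>r \<le> s\<close> because, all orders in the algebra
  being multiples of \<open>r\<close>, there are too few of them for the monomials \<open>L\<^sup>i M\<^sup>j\<close> with \<open>j \<le> n / r\<close> to be
  linearly independent over the constants.
\<close>

subsection \<open>The derivation on rational functions\<close>

text \<open>The definition takes an arbitrary representative by \<open>SOME\<close>; differentiating
  \<open>p * b = a * q\<close> shows that the quotient rule gives the same fraction for all of
  them.\<close>

lemma rf_deriv_Fract: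
  assumes q: "q \<noteq> 0"
  shows "rf_deriv (Fract p q) = Fract (pderiv p * q - p * pderiv q) (q * q)"
proof -
  define pq where "pq = (SOME pq. snd pq \<noteq> 0 \<and> Fract p q = Fract (fst pq) (snd pq))"
  have "snd pq \<noteq> 0 \<and> Fract p q = Fract (fst pq) (snd pq)"
    unfolding pq_def by (rule someI[of _ "(p, q)"]) (use q in simp)
  then obtain a b where ab: "pq = (a, b)" "b \<noteq> 0" and e: "p * b = a * q"
    using q by (cases pq) (auto simp: eq_fract)
  have d: "pderiv p * b + p * pderiv b = pderiv a * q + a * pderiv q"
    using arg_cong[OF e, of pderiv] by (simp add: pderiv_mult algebra_simps)
  have "(pderiv a * b - a * pderiv b) * (q * q) = (pderiv p * q - p * pderiv q) * (b * b)"
  proof -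
    have "pderiv a * q = pderiv p * b + p * pderiv b - a * pderiv q" using d by (simp add: algebra_simps)
    moreover have "(pderiv a * b - a * pderiv b) * (q * q)
       = (pderiv a * q) * (b * q) - (a * q) * pderiv b * q"
      by (simp add: algebra_simps)
    ultimately have "(pderiv a * b - a * pderiv b) * (q * q)
       = (pderiv p * b + p * pderiv b - a * pderiv q) * (b * q) - (a * q) * pderiv b * q"
      by simp
    also have "\<dots> = (pderiv p * b + p * pderiv b) * (b * q) - (a * q) * pderiv q * b - (a * q) * pderiv b * q"
      by (simp add: algebra_simps)
    also have "\<dots> = (pderiv p * q - p * pderiv q) * (b * b)"
      unfolding e[symmetric] by (simp add: algebra_simps)
    finally show ?thesis .
  qed
  then have "Fract (pderiv a * b - a * pderiv b) (b * b) = Fract (pderiv p * q - p * pderiv q) (q * q)"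
    using q ab by (simp add: eq_fract)
  then show ?thesis
    unfolding rf_deriv_def Let_def pq_def[symmetric] ab by simp
qed

lemma rf_deriv_add: "rf_deriv (x + y) = rf_deriv x + rf_deriv y"
proof -
  obtain a b where x: "x = Fract a b" "b \<noteq> 0" by (cases x) auto
  obtain c d where y: "y = Fract c d" "d \<noteq> 0" by (cases y) auto
  show ?thesis using x y
    by (simp add: rf_deriv_Fract eq_fract pderiv_mult pderiv_add algebra_simps)
qed

lemma rf_deriv_mult: "rf_deriv (x * y) = rf_deriv x * y + x * rf_deriv y"
proof -
  obtain a b where x: "x = Fract a b" "b \<noteq> 0" by (cases x) auto
  obtain c d where y: "y = Fract c d" "d \<noteq> 0" by (cases y) auto
  show ?thesis using x y
    by (simp add: rf_deriv_Fract eq_fract pderiv_mult pderiv_add algebra_simps)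
qed

lemma rf_deriv_cst [simp]: "rf_deriv (cst c) = 0"
  by (simp add: cst_def to_fract_def rf_deriv_Fract pderiv_pCons Zero_fract_def)

lemma cst_hom [simp]:
  "cst 0 = 0" "cst 1 = 1" "cst (a + b) = cst a + cst b" "cst (a - b) = cst a - cst b"
  "cst (- a) = - cst a" "cst (a * b) = cst a * cst b"
  unfolding cst_def
  by (simp_all flip: to_fract_add to_fract_diff to_fract_uminus to_fract_mult add: one_pCons[symmetric])

lemma cst_eq_iff [simp]: "cst a = cst b \<longleftrightarrow> a = b"
  by (simp add: cst_def)

lemma cst_eq_0_iff [simp]: "cst a = 0 \<longleftrightarrow> a = 0"
  using cst_eq_iff[of a 0] by (simp del: cst_eq_iff)

lemma cst_power [simp]: "cst (a ^ n) = cst a ^ n"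
  by (induction n) auto

lemma of_nat_eq_cst: "of_nat n = cst (of_nat n)"
  by (induction n) auto

lemma of_nat_rf_eq_0_iff [simp]: "(of_nat n :: rf) = 0 \<longleftrightarrow> n = 0"
  unfolding of_nat_eq_cst by simp

lemma rf_deriv_0 [simp]: "rf_deriv 0 = 0" and rf_deriv_1 [simp]: "rf_deriv 1 = 0"
  using rf_deriv_cst[of 0] rf_deriv_cst[of 1] by simp_all

text \<open>Leading coefficients of the two products can only agree if the degrees do, by
  characteristic zero; constants are treated apart.\<close>

lemma degree_eq_of_wronskian_zero:
  fixes p q :: "complex poly"
  assumes "pderiv p * q = p * pderiv q" "p \<noteq> 0" "q \<noteq> 0"
  shows "degree p = degree q"
proof (cases "degree p = 0 \<or> degree q = 0")
  case True
  then have "pderiv p = 0 \<or> pderiv q = 0" by (simp add: pderiv_eq_0_iff)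
  then have "pderiv p = 0 \<and> pderiv q = 0" using assms by auto
  then show ?thesis by (simp add: pderiv_eq_0_iff)
next
  case False
  then have "pderiv p \<noteq> 0" "pderiv q \<noteq> 0" by (simp_all add: pderiv_eq_0_iff)
  have "lead_coeff (pderiv p) * lead_coeff q = lead_coeff p * lead_coeff (pderiv q)"
    using arg_cong[OF assms(1), of lead_coeff] by (simp add: lead_coeff_mult)
  then have "of_nat (degree p) * (lead_coeff p * lead_coeff q) = of_nat (degree q) * (lead_coeff p * lead_coeff q)"
    using False by (simp add: degree_pderiv coeff_pderiv algebra_simps)
  then show ?thesis using assms by simp
qed

text \<open>Choose \<open>c\<close> to remove the coefficient of \<open>p\<close> at the degree of
  \<open>q\<close>. A nonzero \<open>p - c q\<close> would still have zero Wronskian with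
  \<open>q\<close>, hence the degree of \<open>q\<close>, where its coefficient vanishes.\<close>

lemma rf_deriv_eq_0E:
  assumes "rf_deriv z = 0"
  obtains c where "z = cst c"
proof -
  obtain p q where z: "z = Fract p q" and q: "q \<noteq> 0" by (cases z) auto
  have w: "pderiv p * q = p * pderiv q"
    using assms q unfolding z by (simp add: rf_deriv_Fract Zero_fract_def eq_fract)
  define c where "c = coeff p (degree q) / lead_coeff q"
  have "p - smult c q = 0"
  proof (rule ccontr)
    assume n: "p - smult c q \<noteq> 0"
    have "pderiv (p - smult c q) * q = (p - smult c q) * pderiv q"
      using w by (simp add: pderiv_diff pderiv_smult algebra_simps)
    then have "degree (p - smult c q) = degree q"
      using n q by (rule degree_eq_of_wronskian_zero)
    moreover have "coeff (p - smult c q) (degree q) = 0"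
      using q by (simp add: c_def)
    ultimately show False using n by (metis leading_coeff_0_iff)
  qed
  then have "z = cst c" using q by (simp add: z cst_def to_fract_def eq_fract)
  then show ?thesis by (rule that)
qed

subsection \<open>The ring of differential operators\<close>

notation dmult (infixl \<open>\<star>\<close> 70)

text \<open>Left multiplication by \<open>\<partial>\<close>, from \<open>\<partial> b = b \<partial> + b'\<close>.\<close>
definition dX :: "dop \<Rightarrow> dop" where
  "dX B = pCons 0 B + map_poly rf_deriv B"

lemma coeff_dX: "coeff (dX B) i = (case i of 0 \<Rightarrow> 0 | Suc j \<Rightarrow> coeff B j) + rf_deriv (coeff B i)"
  by (simp add: dX_def coeff_pCons coeff_map_poly)

lemma dX_add: "dX (A + B) = dX A + dX B"
  by (rule poly_eqI) (simp add: coeff_dX rf_deriv_add split: nat.split)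

lemma dX_0 [simp]: "dX 0 = 0"
  by (rule poly_eqI) (simp add: coeff_dX split: nat.split)

lemma dX_smult: "dX (smult a B) = smult a (dX B) + smult (rf_deriv a) B"
  by (rule poly_eqI) (simp add: coeff_dX rf_deriv_mult algebra_simps split: nat.split)

lemma dX_sum: "dX (\<Sum>i\<in>I. f i) = (\<Sum>i\<in>I. dX (f i))"
  by (induction I rule: infinite_finite_induct) (auto simp: dX_add)

lemma dX_iter_add: "(dX ^^ i) (A + B) = (dX ^^ i) A + (dX ^^ i) B"
  by (induction i) (auto simp: dX_add)

lemma dX_iter_0 [simp]: "(dX ^^ i) 0 = 0"
  by (induction i) auto

lemma degree_dX: "B \<noteq> 0 \<Longrightarrow> degree (dX B) = Suc (degree B)"
  by (intro antisym degree_le le_degree) (auto simp: coeff_dX coeff_eq_0 split: nat.split)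

lemma degree_dX_iter: "B \<noteq> 0 \<Longrightarrow> (dX ^^ i) B \<noteq> 0 \<and> degree ((dX ^^ i) B) = i + degree B"
proof (induction i)
  case (Suc i)
  then have "degree (dX ((dX ^^ i) B)) = Suc (i + degree B)" by (simp add: degree_dX)
  then show ?case by (auto intro!: notI)
qed auto

text \<open>The Leibniz rule, by Pascal's rule; it links iterated left multiplication by \<partial>
  to the binomial sums defining \<open>dmult\<close>.\<close>

lemma dX_iter_monom: "(dX ^^ i) (monom b k) = (\<Sum>j\<le>i. monom (of_nat (i choose j) * (rf_deriv ^^ j) b) (i - j + k))"
proof (induction i)
  case (Suc i)
  have dm: "dX (monom (of_nat l * x) k) = monom (of_nat l * x) (Suc k) + monom (of_nat l * rf_deriv x) k" for l x k
    by (rule poly_eqI) (auto simp: coeff_dX rf_deriv_mult of_nat_eq_cst split: nat.split)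
  let ?m = "\<lambda>j l. monom (of_nat l * (rf_deriv ^^ j) b)"
  have "(dX ^^ Suc i) (monom b k) = (\<Sum>j\<le>i. ?m j (i choose j) (Suc i - j + k)) + (\<Sum>j\<le>i. ?m (Suc j) (i choose j) (i - j + k))"
    by (simp add: Suc dX_sum dm sum.distrib Suc_diff_le)
  also have "(\<Sum>j\<le>i. ?m j (i choose j) (Suc i - j + k)) = (\<Sum>j\<le>Suc i. ?m j (i choose j) (Suc i - j + k))"
    by (simp add: binomial_eq_0)
  also have "\<dots> = ?m 0 1 (Suc i + k) + (\<Sum>j\<le>i. ?m (Suc j) (i choose Suc j) (i - j + k))"
    by (subst sum.atMost_Suc_shift) simp
  finally have "(dX ^^ Suc i) (monom b k) = ?m 0 1 (Suc i + k) + (\<Sum>j\<le>i. ?m (Suc j) (Suc i choose Suc j) (Suc i - Suc j + k))"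
    by (simp add: sum.distrib[symmetric] add_monom algebra_simps)
  also have "\<dots> = (\<Sum>j\<le>Suc i. ?m j (Suc i choose j) (Suc i - j + k))"
    by (subst sum.atMost_Suc_shift) simp
  finally show ?case .
qed simp

lemma dX_iter_sum: "(dX ^^ i) (\<Sum>k\<in>I. f k) = (\<Sum>k\<in>I. (dX ^^ i) (f k))"
  by (induction I rule: infinite_finite_induct) (auto simp: dX_iter_add)

lemma dmult_eq_sum_dX: "A \<star> B = (\<Sum>i\<le>degree A. smult (coeff A i) ((dX ^^ i) B))"
proof -
  have "smult a ((dX ^^ i) B) = (\<Sum>k\<le>degree B. \<Sum>j\<le>i.
      monom (a * of_nat (i choose j) * (rf_deriv ^^ j) (coeff B k)) (i - j + k))" for a i
  proof -
    have "(dX ^^ i) B = (\<Sum>k\<le>degree B. (dX ^^ i) (monom (coeff B k) k))"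
      by (subst (1) poly_as_sum_of_monoms[of B, symmetric]) (rule dX_iter_sum)
    then show ?thesis
      by (simp add: dX_iter_monom smult_sum2 smult_monom mult.assoc)
  qed
  then show ?thesis by (simp add: dmult_def)
qed

lemma dmult_0_left [simp]: "0 \<star> B = 0"
  by (simp add: dmult_eq_sum_dX)

text \<open>\<open>pCons a A\<close> is the operator \<open>a + A \<partial>\<close>. This recursion
  replaces the binomial sums in the inductions for the ring laws.\<close>

lemma dmult_pCons: "pCons a A \<star> B = smult a B + A \<star> dX B"
proof (cases "A = 0")
  case False
  then show ?thesis
    by (simp add: dmult_eq_sum_dX sum.atMost_Suc_shift funpow_Suc_right del: funpow.simps(2) sum.atMost_Suc)
qed (simp add: dmult_eq_sum_dX)

lemma dmult_0_right [simp]: "A \<star> 0 = 0"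
  by (induction A) (auto simp: dmult_pCons)

lemma dmult_add_right: "A \<star> (B + C) = A \<star> B + A \<star> C"
  by (induction A arbitrary: B C) (auto simp: dmult_pCons dX_add smult_add_right algebra_simps)

lemma dmult_add_left: "(A + B) \<star> C = A \<star> C + B \<star> C"
proof (induction A arbitrary: B C)
  case (pCons a A)
  obtain b B' where B: "B = pCons b B'" by (cases B)
  show ?case by (simp add: B dmult_pCons pCons.IH smult_add_left algebra_simps)
qed simp

lemma dmult_smult_left: "smult a A \<star> B = smult a (A \<star> B)"
  by (induction A arbitrary: B) (auto simp: dmult_pCons smult_add_right)

text \<open>Associativity with left factor \<partial>; with the recursion on \<open>pCons\<close> it
  yields the general law.\<close>

lemma dX_dmult: "dX A \<star> B = dX (A \<star> B)"
proof (induction A arbitrary: B)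
  case (pCons a A)
  have "dX (pCons a A) = pCons (rf_deriv a) (dX A + [:a:])"
    by (rule poly_eqI) (auto simp: coeff_dX coeff_pCons split: nat.split)
  then show ?case
    by (simp add: dmult_pCons dmult_add_left pCons.IH dX_add dX_smult algebra_simps)
qed simp

lemma dmult_assoc: "(A \<star> B) \<star> C = A \<star> (B \<star> C)"
  by (induction A arbitrary: B C) (auto simp: dmult_pCons dmult_add_left dmult_smult_left dX_dmult)

lemma dmult_const_left [simp]: "[:a:] \<star> B = smult a B"
  by (simp add: dmult_pCons)

lemma dmult_1_left [simp]: "1 \<star> B = B"
  by (simp add: one_pCons)

lemma dmult_smult_cst_right: "A \<star> smult (cst c) B = smult (cst c) (A \<star> B)"
  by (induction A arbitrary: B) (auto simp: dmult_pCons dX_smult smult_add_right mult.commute)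

lemma dmult_1_right [simp]: "A \<star> 1 = A"
proof (induction A)
  case (pCons a A)
  have "A \<star> [:0, 1:] = pCons 0 A" if "A \<star> 1 = A" for A
  proof -
    have *: "A \<star> pCons 0 B = pCons 0 (A \<star> B)" for B
    proof (induction A arbitrary: B)
      case (pCons a A)
      have "dX (pCons 0 B) = pCons 0 (dX B)"
        by (rule poly_eqI) (auto simp: coeff_dX coeff_pCons split: nat.split)
      then show ?case by (simp add: dmult_pCons pCons.IH)
    qed simp
    show ?thesis using *[of 1] that by (simp add: one_pCons)
  qed
  moreover have "dX 1 = [:0, 1:]"
    by (rule poly_eqI) (auto simp: coeff_dX coeff_pCons one_pCons split: nat.split)
  ultimately show ?case using pCons by (simp add: dmult_pCons one_pCons)
qed simp

lemma dmult_cst_right [simp]: "A \<star> [:cst c:] = smult (cst c) A"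
proof -
  have "A \<star> smult (cst c) 1 = smult (cst c) A" by (subst dmult_smult_cst_right) simp
  then show ?thesis by (simp add: one_pCons)
qed

lemma dmult_minus_left: "(- A) \<star> B = - (A \<star> B)"
  using dmult_smult_left[of "-1" A B] by simp

lemma dmult_minus_right: "A \<star> (- B) = - (A \<star> B)"
  using dmult_smult_cst_right[of A "-1" B] by simp

lemma dmult_diff_left: "(A - B) \<star> C = A \<star> C - B \<star> C"
  using dmult_add_left[of A "- B" C] by (simp add: dmult_minus_left)

lemma dmult_diff_right: "A \<star> (B - C) = A \<star> B - A \<star> C"
  using dmult_add_right[of A B "- C"] by (simp add: dmult_minus_right)

lemma dmult_sum_left: "(\<Sum>i\<in>I. f i) \<star> B = (\<Sum>i\<in>I. f i \<star> B)"
  by (induction I rule: infinite_finite_induct) (auto simp: dmult_add_left)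

lemmas dmult_distribs = dmult_add_left dmult_add_right dmult_diff_left dmult_diff_right
  dmult_minus_left dmult_minus_right dmult_smult_left

text \<open>Moving coefficients across \<partial> only adds terms of lower order, so leading
  coefficients multiply as for commutative polynomials.\<close>

lemma coeff_dmult_top: 
  "coeff (A \<star> B) (degree A + degree B) = lead_coeff A * lead_coeff B"
  "i > degree A + degree B \<Longrightarrow> coeff (A \<star> B) i = 0"
proof -
  have *: "coeff (A \<star> B) (degree A + degree B) = lead_coeff A * lead_coeff B \<and>
     (\<forall>i > degree A + degree B. coeff (A \<star> B) i = 0)" if "B \<noteq> 0" for B using that
  proof (induction A arbitrary: B)
    case (pCons a A)
    show ?case
    proof (cases "A = 0")
      case False
      have d: "degree (dX B) = Suc (degree B)" using pCons.prems by (rule degree_dX)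
      then have "dX B \<noteq> 0" by auto
      note IH = pCons.IH[OF this, unfolded d]
      have "lead_coeff (dX B) = lead_coeff B" unfolding d
        by (simp add: coeff_dX coeff_eq_0)
      then show ?thesis using False IH d
        by (auto simp: dmult_pCons coeff_eq_0)
    qed (simp add: dmult_pCons coeff_eq_0)
  qed auto
  show "coeff (A \<star> B) (degree A + degree B) = lead_coeff A * lead_coeff B"
    "i > degree A + degree B \<Longrightarrow> coeff (A \<star> B) i = 0"
    using * by (cases "B = 0"; auto)+
qed

lemma degree_dmult: "A \<noteq> 0 \<Longrightarrow> B \<noteq> 0 \<Longrightarrow> degree (A \<star> B) = degree A + degree B"
  by (intro antisym degree_le le_degree) (auto simp: coeff_dmult_top)

lemma dmult_eq_0_iff [simp]: "A \<star> B = 0 \<longleftrightarrow> A = 0 \<or> B = 0"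
  using coeff_dmult_top(1)[of A B] by auto

lemma dpow_mult_eq: "dpow_mult j P = (dX ^^ j) P"
proof -
  have "monom 1 j \<star> P = (dX ^^ j) P"
    by (induction j arbitrary: P)
       (auto simp: monom_0 monom_Suc dmult_pCons funpow_Suc_right simp del: funpow.simps(2))
  then show ?thesis by (simp add: dpow_mult_def)
qed

lemma dX_iter_dmult: "(dX ^^ i) A \<star> B = (dX ^^ i) (A \<star> B)"
  by (induction i) (auto simp: dX_dmult)

lemma dX_iter_eq: "(dX ^^ i) A = (dX ^^ i) 1 \<star> A"
  by (simp add: dX_iter_dmult)

section \<open>Leading coefficients of commuting operators\<close>

definition subcoeff :: "dop \<Rightarrow> rf" where
  "subcoeff A = (case degree A of 0 \<Rightarrow> 0 | Suc d \<Rightarrow> coeff A d)"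

text \<open>The only derivative at this order comes from moving the leading power of \<partial> in
  \<open>A\<close> across the leading coefficient of \<open>B\<close>. The value 0 of
  \<open>subcoeff\<close> in order 0 lets the formula cover a factor of order 0.\<close>

lemma coeff_dmult_subleading:
  assumes "A \<noteq> 0" "B \<noteq> 0" "degree A + degree B > 0"
  shows "coeff (A \<star> B) (degree A + degree B - 1) =
    lead_coeff A * subcoeff B + of_nat (degree A) * lead_coeff A * rf_deriv (lead_coeff B)
      + subcoeff A * lead_coeff B"
  using assms
proof (induction A arbitrary: B)
  case (pCons a A)
  show ?case
  proof (cases "A = 0")
    case True
    then show ?thesis using pCons.prems
      by (cases "degree B") (auto simp: dmult_pCons subcoeff_def)
  next
    case False
    have d: "degree (dX B) = Suc (degree B)" using pCons.prems(2) by (rule degree_dX)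
    then have n: "dX B \<noteq> 0" by auto
    have l: "coeff (dX B) (Suc (degree B)) = lead_coeff B"
      by (simp add: coeff_dX coeff_eq_0)
    have s: "subcoeff (dX B) = subcoeff B + rf_deriv (lead_coeff B)"
      by (auto simp: subcoeff_def d coeff_dX split: nat.split)
    have "subcoeff (pCons a A) = subcoeff A + (if degree A = 0 then a else 0)"
      using False by (auto simp: subcoeff_def coeff_pCons split: nat.split)
    then show ?thesis
      using pCons.IH[OF False n] False unfolding d
      by (cases "degree A") (auto simp: dmult_pCons l s coeff_eq_0 algebra_simps)
  qed
qed simp

text \<open>In the second-highest coefficients of the two products the terms with
  \<open>subcoeff\<close> agree and cancel; the derivative terms remain.\<close>

lemma lead_coeff_commuting:
  assumes "A \<star> L = L \<star> A" "A \<noteq> 0" "degree L > 0"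
  shows "of_nat (degree L) * lead_coeff L * rf_deriv (lead_coeff A)
       = of_nat (degree A) * lead_coeff A * rf_deriv (lead_coeff L)"
proof -
  have L: "L \<noteq> 0" using assms by auto
  have "coeff (A \<star> L) (degree A + degree L - 1) = coeff (L \<star> A) (degree L + degree A - 1)"
    using assms by (simp add: add.commute)
  then show ?thesis
    using coeff_dmult_subleading[of A L] coeff_dmult_subleading[of L A] assms L
    by (simp add: algebra_simps)
qed

text \<open>Both leading coefficients solve the same first-order linear equation, so their quotient
  has derivative zero.\<close>

lemma lead_coeff_commuting_proportional:
  assumes A: "A \<star> L = L \<star> A" "A \<noteq> 0" and B: "B \<star> L = L \<star> B" "B \<noteq> 0"
    and deg: "degree A = degree B" and L: "degree L > 0"
  obtains c where "lead_coeff A = cst c * lead_coeff B"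
proof -
  let ?a = "lead_coeff A" and ?b = "lead_coeff B" and ?l = "of_nat (degree L) * lead_coeff L"
  have l: "?l \<noteq> 0" using L by auto
  have "?l * (rf_deriv ?a * ?b) = ?l * (?a * rf_deriv ?b)"
    using lead_coeff_commuting[OF A L] lead_coeff_commuting[OF B L] deg
    by (simp add: algebra_simps)
  then have e: "rf_deriv ?a * ?b = ?a * rf_deriv ?b" using l by (simp only: mult_cancel_left) blast
  have a: "?a = (?a / ?b) * ?b" using B by simp
  have "rf_deriv ?a = rf_deriv (?a / ?b) * ?b + ?a / ?b * rf_deriv ?b"
    by (subst a) (rule rf_deriv_mult)
  then have "rf_deriv ?a * ?b = rf_deriv (?a / ?b) * ?b * ?b + ?a * rf_deriv ?b"
    using B by (simp add: field_simps)
  then have "rf_deriv (?a / ?b) = 0" using e B by simp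
  then obtain c where "?a / ?b = cst c" by (rule rf_deriv_eq_0E)
  with a have "?a = cst c * ?b" by simp
  then show ?thesis by (rule that)
qed

subsection \<open>Right division and greatest common right divisors\<close>

lemma right_division:
  assumes P: "P \<noteq> 0"
  shows "\<exists>Q R. A = Q \<star> P + R \<and> (R = 0 \<or> degree R < degree P)"
proof (induction "degree A" arbitrary: A rule: less_induct)
  case less
  show ?case
  proof (cases "A = 0 \<or> degree A < degree P")
    case True
    then show ?thesis by (intro exI[of _ 0] exI[of _ A]) auto
  next
    case False
    define C where "C = monom (lead_coeff A / lead_coeff P) (degree A - degree P)"
    define A' where "A' = A - C \<star> P"
    have C: "C \<noteq> 0" "degree C = degree A - degree P"
      using False P by (auto simp: C_def degree_monom_eq)
    have dC: "degree C + degree P = degree A" using C False by auto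
    have top: "coeff (C \<star> P) (degree A) = lead_coeff A"
      using coeff_dmult_top(1)[of C P] P unfolding dC by (simp add: C_def degree_monom_eq C(2)[unfolded C_def])
    have deg: "degree A' \<le> degree A"
      unfolding A'_def using degree_dmult[OF C(1) P] dC by (intro degree_diff_le) auto
    show ?thesis
    proof (cases "A' = 0")
      case True
      then show ?thesis by (intro exI[of _ C] exI[of _ 0]) (simp add: A'_def)
    next
      case False
      have "coeff A' (degree A) = 0" by (simp add: A'_def top)
      then have "degree A' < degree A" using deg False
        by (metis le_neq_implies_less leading_coeff_0_iff)
      from less[OF this] obtain Q R where "A' = Q \<star> P + R" "R = 0 \<or> degree R < degree P" by blast
      then show ?thesis
        by (intro exI[of _ "C + Q"] exI[of _ R]) (auto simp: A'_def dmult_distribs algebra_simps)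
    qed
  qed
qed

lemma rdvd_refl [simp]: "rdvd G G"
  unfolding rdvd_def by (rule exI[of _ 1]) simp

lemma rdvd_0 [simp]: "rdvd G 0"
  unfolding rdvd_def by (rule exI[of _ 0]) simp

lemma rdvd_add: "rdvd G A \<Longrightarrow> rdvd G B \<Longrightarrow> rdvd G (A + B)"
  unfolding rdvd_def by (metis dmult_add_left)

lemma rdvd_diff: "rdvd G A \<Longrightarrow> rdvd G B \<Longrightarrow> rdvd G (A - B)"
  unfolding rdvd_def by (metis dmult_diff_left)

lemma rdvd_dmult: "rdvd G A \<Longrightarrow> rdvd G (B \<star> A)"
  unfolding rdvd_def by (metis dmult_assoc)

lemma rdvd_smult: "rdvd G A \<Longrightarrow> rdvd G (smult c A)"
  unfolding rdvd_def by (metis dmult_smult_left)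

lemma rdvd_dX_iter: "rdvd G A \<Longrightarrow> rdvd G ((dX ^^ i) A)"
  by (subst dX_iter_eq) (rule rdvd_dmult)

lemma rdvd_trans: "rdvd F G \<Longrightarrow> rdvd G A \<Longrightarrow> rdvd F A"
  unfolding rdvd_def by (metis dmult_assoc)

lemma rdvd_sum: "(\<And>i. i \<in> I \<Longrightarrow> rdvd G (f i)) \<Longrightarrow> rdvd G (\<Sum>i\<in>I. f i)"
  by (induction I rule: infinite_finite_induct) (auto intro: rdvd_add)

lemma rdvd_degree_le: "rdvd G A \<Longrightarrow> A \<noteq> 0 \<Longrightarrow> degree G \<le> degree A"
  unfolding rdvd_def by (auto simp: degree_dmult)

text \<open>If \<open>A = C P\<close>, then \<open>A B = C P B = (C B) P\<close>.\<close>

lemma rdvd_dmult_commuting: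
  assumes "rdvd P A" "P \<star> B = B \<star> P"
  shows "rdvd P (A \<star> B)"
  using assms unfolding rdvd_def by (metis dmult_assoc)

text \<open>A generator of the left ideal of \<open>P\<close> and \<open>Q\<close>; the explicit
  combination is what the later order estimates use.\<close>

definition bezout_gcrd :: "dop \<Rightarrow> dop \<Rightarrow> dop \<Rightarrow> bool" where
  "bezout_gcrd G P Q \<longleftrightarrow> G \<noteq> 0 \<and> rdvd G P \<and> rdvd G Q \<and> (\<exists>U V. G = U \<star> P + V \<star> Q)"

lemma bezout_gcrd_commute: "bezout_gcrd G P Q \<longleftrightarrow> bezout_gcrd G Q P"
  unfolding bezout_gcrd_def by (metis add.commute)

lemma bezout_gcrd_exists:
  assumes "P \<noteq> 0"
  obtains G where "bezout_gcrd G P Q"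
proof -
  \<comment> \<open>A nonzero element of least order in the left ideal divides every other one,
    since remainders stay in the ideal.\<close>
  define S where "S = {A. A \<noteq> 0 \<and> (\<exists>U V. A = U \<star> P + V \<star> Q)}"
  have "P = 1 \<star> P + 0 \<star> Q" by simp
  then have "P \<in> S" using assms unfolding S_def by blast
  then obtain G where G: "G \<in> S" and min: "\<And>A. A \<in> S \<Longrightarrow> degree G \<le> degree A"
    using arg_min_natI[of "\<lambda>A. A \<in> S" P degree] arg_min_nat_le[of "\<lambda>A. A \<in> S" _ degree] by metis
  obtain U V where UV: "G = U \<star> P + V \<star> Q" and G0: "G \<noteq> 0" using G by (auto simp: S_def)
  have "rdvd G (A \<star> P + B \<star> Q)" for A B
  proof -
    obtain C R where CR: "A \<star> P + B \<star> Q = C \<star> G + R" "R = 0 \<or> degree R < degree G"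
      using right_division[OF G0] by metis
    have "R = (A - C \<star> U) \<star> P + (B - C \<star> V) \<star> Q"
      using CR(1) unfolding UV by (simp add: dmult_distribs dmult_assoc algebra_simps)
    then have "R \<noteq> 0 \<Longrightarrow> R \<in> S" by (auto simp: S_def)
    with min CR(2) have "R = 0" by force
    with CR show ?thesis by (auto simp: rdvd_def)
  qed
  from this[of 1 0] this[of 0 1] have "bezout_gcrd G P Q"
    using UV G0 by (auto simp: bezout_gcrd_def)
  then show ?thesis by (rule that)
qed

lemma bezout_gcrd_imp_is_gcrd:
  assumes G: "bezout_gcrd G P Q" and c: "c \<noteq> 0"
  shows "is_gcrd (smult c G) P Q"
proof -
  have "rdvd (smult c G) G"
    unfolding rdvd_def using c by (intro exI[of _ "[:1 / c:]"]) simp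
  then have "rdvd (smult c G) P" "rdvd (smult c G) Q"
    using G rdvd_trans unfolding bezout_gcrd_def by blast+
  moreover have "rdvd E (smult c G)" if "rdvd E P" "rdvd E Q" for E
  proof -
    obtain U V where "G = U \<star> P + V \<star> Q" using G by (auto simp: bezout_gcrd_def)
    then show ?thesis using that by (auto intro!: rdvd_smult rdvd_add rdvd_dmult)
  qed
  ultimately show ?thesis unfolding is_gcrd_def by blast
qed

subsection \<open>Linear dependence\<close>

text \<open>Padding the \<open>k\<close> coordinates with zero rows gives a square matrix that is
  singular because row \<open>k\<close> vanishes; a kernel vector is the relation.\<close>

lemma exists_linear_dependence:
  fixes v :: "nat \<Rightarrow> nat \<Rightarrow> 'a :: field"
  assumes "k < l"
  obtains c where "\<exists>i<l. c i \<noteq> 0" "\<And>j. j < k \<Longrightarrow> (\<Sum>i<l. c i * v i j) = 0"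
proof -
  define A where "A = mat l l (\<lambda>(j, i). if j < k then v i j else 0)"
  have A: "A \<in> carrier_mat l l" by (simp add: A_def)
  have "transpose_mat A *\<^sub>v unit_vec l k = 0\<^sub>v l"
    using assms by (intro eq_vecI) (auto simp: A_def)
  moreover have "unit_vec l k \<noteq> (0\<^sub>v l :: 'a vec)" using assms by simp
  ultimately have "det (transpose_mat A) = 0"
    using A by (subst det_0_iff_vec_prod_zero_field[of _ l]) (auto intro!: exI[of _ "unit_vec l k"])
  then have "det A = 0" by (simp add: det_transpose[OF A])
  then obtain x where x: "x \<in> carrier_vec l" "x \<noteq> 0\<^sub>v l" "A *\<^sub>v x = 0\<^sub>v l"
    using det_0_iff_vec_prod_zero_field[OF A] by blast
  show ?thesis
  proof
    show "\<exists>i<l. x $ i \<noteq> 0" using x by (auto simp: vec_eq_iff)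
    fix j assume j: "j < k"
    have "(A *\<^sub>v x) $ j = 0" using x(3) j assms by simp
    then have "(\<Sum>i = 0..<l. v i j * x $ i) = 0"
      using j assms x(1) by (simp add: A_def scalar_prod_def)
    then show "(\<Sum>i<l. x $ i * v i j) = 0"
      by (simp add: lessThan_atLeast0 mult.commute)
  qed
qed

lemma exists_dop_dependence:
  fixes X :: "nat \<Rightarrow> dop"
  assumes "k < l" "\<And>i j. i < l \<Longrightarrow> k \<le> j \<Longrightarrow> coeff (X i) j = 0"
  shows "\<exists>c. (\<exists>i<l. c i \<noteq> 0) \<and> (\<Sum>i<l. smult (c i) (X i)) = 0"
proof -
  obtain c where c: "\<exists>i<l. c i \<noteq> 0" "\<And>j. j < k \<Longrightarrow> (\<Sum>i<l. c i * coeff (X i) j) = 0"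
    using exists_linear_dependence[OF assms(1), of "\<lambda>i. coeff (X i)"] by blast
  have "(\<Sum>i<l. c i * coeff (X i) j) = 0" for j
    using c(2)[of j] assms(2)[of _ j] by (cases "j < k") auto
  then have "(\<Sum>i<l. smult (c i) (X i)) = 0"
    by (intro poly_eqI) (simp add: coeff_sum)
  with c(1) show ?thesis by blast
qed

lemma dmult_monom_left: "monom a i \<star> B = smult a ((dX ^^ i) B)"
  using dmult_smult_left[of a "monom 1 i" B] dpow_mult_eq[of i B]
  by (simp add: dpow_mult_def smult_monom)

lemma coeff_sum_monom: "coeff (\<Sum>i<b. monom (c i) i) j = (if j < b then c j else 0)"
  by (simp add: coeff_sum)

lemma sum_monom_dmult: "(\<Sum>i<b. monom (c i) i) \<star> B = (\<Sum>i<b. smult (c i) ((dX ^^ i) B))"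
  by (simp add: dmult_sum_left dmult_monom_left)

text \<open>If \<open>B\<close> had order below \<open>degree P - degree G\<close>, that many
  remainders of \<partial>^i V modulo \<open>B\<close> would be dependent. This gives
  \<open>E\<close> with \<open>E V\<close> a left multiple of \<open>B\<close>, so \<open>P\<close>
  right-divides \<open>E G\<close>, a nonzero operator of smaller order.\<close>

lemma syzygy_degree_ge:
  assumes G: "bezout_gcrd G P Q" and P: "P \<noteq> 0" and B: "B \<noteq> 0" and syz: "rdvd P (B \<star> Q)"
  shows "degree P \<le> degree B + degree G"
proof (rule ccontr)
  assume "\<not> ?thesis"
  then have lt: "degree B < degree P - degree G" by simp
  obtain U V where UV: "G = U \<star> P + V \<star> Q" and G0: "G \<noteq> 0" using G by (auto simp: bezout_gcrd_def)
  have "\<exists>C R. (dX ^^ i) V = C \<star> B + R \<and> (R = 0 \<or> degree R < degree B)" for i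
    by (rule right_division[OF B])
  then obtain C R where CR: "\<And>i. (dX ^^ i) V = C i \<star> B + R i" "\<And>i. R i = 0 \<or> degree (R i) < degree B"
    by metis
  have Rz: "coeff (R i) j = 0" if "degree B \<le> j" for i j
    using CR(2)[of i] that by (auto intro: coeff_eq_0)
  have "\<exists>c. (\<exists>i<degree P - degree G. c i \<noteq> 0) \<and> (\<Sum>i<degree P - degree G. smult (c i) (R i)) = 0"
    by (rule exists_dop_dependence[OF lt]) (rule Rz)
  then obtain c where c: "\<exists>i<degree P - degree G. c i \<noteq> 0"
      "(\<Sum>i<degree P - degree G. smult (c i) (R i)) = 0"
    by blast
  define E where "E = (\<Sum>i<degree P - degree G. monom (c i) i)"
  have cE: "coeff E i = (if i < degree P - degree G then c i else 0)" for i
    unfolding E_def by (rule coeff_sum_monom)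
  have E0: "E \<noteq> 0"
  proof
    assume "E = 0"
    then have "(if i < degree P - degree G then c i else 0) = 0" for i using cE[of i] by simp
    then show False using c(1) by metis
  qed
  have "degree E < degree P - degree G"
  proof (rule ccontr)
    assume "\<not> ?thesis"
    then have "lead_coeff E = 0" using cE by simp
    then show False using E0 by simp
  qed
  then have "degree (E \<star> G) < degree P"
    using degree_dmult[OF E0 G0] by simp
  moreover have "rdvd P (E \<star> G)"
  proof -
    have "(dX ^^ i) G = (dX ^^ i) U \<star> P + C i \<star> (B \<star> Q) + R i \<star> Q" for i
      unfolding UV dX_iter_add dX_iter_dmult[symmetric] CR(1) by (simp add: dmult_assoc dmult_add_left)
    then have "E \<star> G = (\<Sum>i<degree P - degree G. smult (c i) ((dX ^^ i) U \<star> P + C i \<star> (B \<star> Q)))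
        + (\<Sum>i<degree P - degree G. smult (c i) (R i)) \<star> Q"
      unfolding E_def sum_monom_dmult
      by (simp add: dmult_sum_left dmult_smult_left smult_add_right sum.distrib)
    then show ?thesis using c(2)
      by (auto intro!: rdvd_sum rdvd_smult rdvd_add rdvd_dmult[OF rdvd_refl] rdvd_dmult[OF syz])
  qed
  moreover have "E \<star> G \<noteq> 0" using E0 G0 by simp
  ultimately show False using rdvd_degree_le by fastforce
qed

subsection \<open>Differential subresultants\<close>

text \<open>The rows are combined as operators, so that singularity yields an operator whose
  selected coefficients all vanish.\<close>

lemma det_coeff_mat_eq_0_iff:
  fixes X :: "nat \<Rightarrow> dop"
  shows "det (mat N N (\<lambda>(a, c). coeff (X a) (g c))) = 0 \<longleftrightarrow>
    (\<exists>v. (\<exists>a<N. v a \<noteq> 0) \<and> (\<forall>c<N. coeff (\<Sum>a<N. smult (v a) (X a)) (g c) = 0))"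
proof -
  define A where "A = mat N N (\<lambda>(a, c). coeff (X a) (g c))"
  have A: "A \<in> carrier_mat N N" "transpose_mat A \<in> carrier_mat N N" by (simp_all add: A_def)
  have mv: "transpose_mat A *\<^sub>v x = 0\<^sub>v N \<longleftrightarrow> (\<forall>c<N. coeff (\<Sum>a<N. smult (x $ a) (X a)) (g c) = 0)"
    if "x \<in> carrier_vec N" for x
    using that by (auto simp: vec_eq_iff A_def scalar_prod_def coeff_sum lessThan_atLeast0 mult.commute)
  have "det A = 0 \<longleftrightarrow> det (transpose_mat A) = 0" by (simp add: det_transpose[OF A(1)])
  also have "\<dots> \<longleftrightarrow> (\<exists>x. x \<in> carrier_vec N \<and> x \<noteq> 0\<^sub>v N \<and> transpose_mat A *\<^sub>v x = 0\<^sub>v N)"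
    by (rule det_0_iff_vec_prod_zero_field[OF A(2)])
  also have "\<dots> \<longleftrightarrow> (\<exists>v. (\<exists>a<N. v a \<noteq> 0) \<and> (\<forall>c<N. coeff (\<Sum>a<N. smult (v a) (X a)) (g c) = 0))"
  proof safe
    fix x assume x: "x \<in> carrier_vec N" "x \<noteq> 0\<^sub>v N" "transpose_mat A *\<^sub>v x = 0\<^sub>v N"
    have "\<exists>a<N. x $ a \<noteq> 0" using x(1,2) by (auto simp: vec_eq_iff)
    moreover have "\<forall>c<N. coeff (\<Sum>a<N. smult (x $ a) (X a)) (g c) = 0"
      using x(3) unfolding mv[OF x(1)] .
    ultimately show "\<exists>v. (\<exists>a<N. v a \<noteq> 0) \<and> (\<forall>c<N. coeff (\<Sum>a<N. smult (v a) (X a)) (g c) = 0)"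
      by (intro exI[of _ "($) x"] conjI)
  next
    fix v a assume v: "a < N" "v a \<noteq> 0" "\<forall>c<N. coeff (\<Sum>a<N. smult (v a) (X a)) (g c) = 0"
    have x: "vec N v \<in> carrier_vec N" by simp
    have "transpose_mat A *\<^sub>v vec N v = 0\<^sub>v N" unfolding mv[OF x] using v(3) by simp
    moreover have "vec N v \<noteq> 0\<^sub>v N" using v(1,2) by (auto simp: vec_eq_iff)
    ultimately show "\<exists>x. x \<in> carrier_vec N \<and> x \<noteq> 0\<^sub>v N \<and> transpose_mat A *\<^sub>v x = 0\<^sub>v N"
      using x by blast
  qed
  finally show ?thesis by (simp add: A_def)
qed

text \<open>Expanding along the last column, the cofactors do not depend on which coefficient the
  last column holds.\<close>
lemma det_last_column_coeff:
  fixes X :: "nat \<Rightarrow> dop"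
  assumes "N > 0"
  obtains w where "\<And>i. det (mat N N (\<lambda>(a, c). coeff (X a) (if c < N - 1 then g c else i)))
     = coeff (\<Sum>a<N. smult (w a) (X a)) i"
proof -
  define A where "A = (\<lambda>i. mat N N (\<lambda>(a, c). coeff (X a) (if c < N - 1 then g c else i)))"
  define w where "w = (\<lambda>a. cofactor (A 0) a (N - 1))"
  have del: "mat_delete (A i) a (N - 1) = mat_delete (A 0) a (N - 1)" if "a < N" for i a
    using assms that by (intro eq_matI) (auto simp: A_def mat_delete_def)
  have cof: "cofactor (A i) a (N - 1) = w a" if "a < N" for i a
    unfolding w_def cofactor_def del[OF that, of i] ..
  have last: "A i $$ (a, N - 1) = coeff (X a) i" if "a < N" for i a
    using assms that by (simp add: A_def)
  have "det (A i) = coeff (\<Sum>a<N. smult (w a) (X a)) i" for i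
  proof -
    have "A i \<in> carrier_mat N N" by (simp add: A_def)
    then have "det (A i) = (\<Sum>a<N. A i $$ (a, N - 1) * cofactor (A i) a (N - 1))"
      by (rule laplace_expansion_column) (use assms in simp)
    also have "\<dots> = (\<Sum>a<N. w a * coeff (X a) i)"
      by (intro sum.cong refl) (simp only: lessThan_iff cof last mult.commute)
    finally show ?thesis by (simp add: coeff_sum)
  qed
  then show ?thesis using that unfolding A_def by blast
qed

lemma sum_lessThan_add: "(\<Sum>a<p + q. f a) = (\<Sum>a<p. f a) + (\<Sum>b<q. f (p + b :: nat))"
  by (induction q) (auto simp: add.assoc)

text \<open>The weights \<open>v\<close> are the coefficients of two cofactors \<open>A\<close> and
  \<open>B\<close> of bounded order, so a row relation is a syzygy of \<open>P\<close> and
  \<open>Q\<close>.\<close>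

lemma sres_row_combination:
  assumes "k \<le> degree P" "k \<le> degree Q"
  obtains A B where "(\<Sum>a<degree P + degree Q - 2 * k. smult (v a) (sres_row P Q k a)) = A \<star> P + B \<star> Q"
    "\<And>i. degree P - k \<le> i \<Longrightarrow> coeff B i = 0"
    "\<And>a. A = 0 \<Longrightarrow> B = 0 \<Longrightarrow> a < degree P + degree Q - 2 * k \<Longrightarrow> v a = 0"
proof -
  let ?n = "degree P - k" and ?m = "degree Q - k"
  \<comment> \<open>The rows carry decreasing powers of \<partial>, hence the reversed
    indices.\<close>
  define A where "A = (\<Sum>i<?m. monom (v (?m - Suc i)) i)"
  define B where "B = (\<Sum>i<?n. monom (v (?m + (?n - Suc i))) i)"
  have N: "degree P + degree Q - 2 * k = ?m + ?n" using assms by simp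
  have "(\<Sum>a<?m + ?n. smult (v a) (sres_row P Q k a))
      = (\<Sum>a<?m. smult (v a) ((dX ^^ (?m - Suc a)) P)) + (\<Sum>b<?n. smult (v (?m + b)) ((dX ^^ (?n - Suc b)) Q))"
    by (simp add: sum_lessThan_add sres_row_def dord_def Let_def dpow_mult_eq)
  also have "(\<Sum>a<?m. smult (v a) ((dX ^^ (?m - Suc a)) P)) = A \<star> P"
    unfolding A_def sum_monom_dmult by (subst sum.nat_diff_reindex[symmetric]) (auto intro!: sum.cong)
  also have "(\<Sum>b<?n. smult (v (?m + b)) ((dX ^^ (?n - Suc b)) Q)) = B \<star> Q"
    unfolding B_def sum_monom_dmult by (subst sum.nat_diff_reindex[symmetric]) (auto intro!: sum.cong)
  finally have 1: "(\<Sum>a<degree P + degree Q - 2 * k. smult (v a) (sres_row P Q k a)) = A \<star> P + B \<star> Q"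
    unfolding N .
  show ?thesis
  proof (rule that[OF 1])
    show "coeff B i = 0" if "?n \<le> i" for i using that by (simp add: B_def coeff_sum_monom)
    fix a assume AB: "A = 0" "B = 0" and a: "a < degree P + degree Q - 2 * k"
    show "v a = 0"
    proof (cases "a < ?m")
      case True
      have "coeff A (?m - Suc a) = v a" using True by (simp add: A_def coeff_sum_monom)
      then show ?thesis using AB by simp
    next
      case False
      have "coeff B (?n - Suc (a - ?m)) = v a" using False a N by (simp add: B_def coeff_sum_monom)
      then show ?thesis using AB by simp
    qed
  qed
qed

text \<open>Moves the case distinction into the coefficient index, the form the determinant lemmas
  above require.\<close>

lemma sres_mat_i_eq:
  assumes "k < degree P" "k < degree Q"
  shows "sres_mat_i P Q k i = mat (degree P + degree Q - 2 * k) (degree P + degree Q - 2 * k)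
    (\<lambda>(a, c). coeff (sres_row P Q k a)
       (if c < degree P + degree Q - 2 * k - 1 then degree P + degree Q - 1 - k - c else i))"
  unfolding sres_mat_i_def Let_def dord_def
  by (intro eq_matI) (auto simp: diff_commute diff_diff_eq)

lemma degree_sres_row:
  assumes "k < degree P" "k < degree Q" "a < degree P + degree Q - 2 * k"
  shows "degree (sres_row P Q k a) < degree P + degree Q - k"
proof -
  have nz: "P \<noteq> 0" "Q \<noteq> 0" using assms by auto
  show ?thesis
  proof (cases "a < degree Q - k")
    case True
    then have "degree (sres_row P Q k a) = degree Q - 1 - k - a + degree P"
      using degree_dX_iter[OF nz(1)] by (simp add: sres_row_def dord_def dpow_mult_eq)
    then show ?thesis using assms True by linarith
  next
    case False
    then have "degree (sres_row P Q k a) = degree P - 1 - k - (a - (degree Q - k)) + degree Q"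
      using degree_dX_iter[OF nz(2)] by (simp add: sres_row_def dord_def dpow_mult_eq)
    then show ?thesis using assms False by linarith
  qed
qed

lemma rdvd_sres_row: "rdvd G P \<Longrightarrow> rdvd G Q \<Longrightarrow> rdvd G (sres_row P Q k a)"
  by (auto simp: sres_row_def Let_def dpow_mult_eq intro!: rdvd_dX_iter)

text \<open>With \<open>n\<close>, \<open>m\<close>, \<open>d\<close> the orders of
  \<open>P\<close>, \<open>Q\<close>, \<open>G\<close>, all \<open>n + m - 2 k\<close> rows are
  \<open>F G\<close> with \<open>F\<close> of order below \<open>n + m - k - d\<close>. For
  \<open>k < d\<close> these are more rows than dimensions, so they are dependent.\<close>

lemma dsubres_eq_0:
  assumes G: "bezout_gcrd G P Q" and P: "P \<noteq> 0" and Q: "Q \<noteq> 0" and k: "k < degree G"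
  shows "dsubres P Q k = 0"
proof -
  have dvd: "rdvd G P" "rdvd G Q" and G0: "G \<noteq> 0" using G by (auto simp: bezout_gcrd_def)
  have kn: "k < degree P" "k < degree Q" "degree G \<le> degree P" "degree G \<le> degree Q"
    using rdvd_degree_le[OF dvd(1) P] rdvd_degree_le[OF dvd(2) Q] k by auto
  let ?N = "degree P + degree Q - 2 * k"
  have "\<exists>F. sres_row P Q k a = F \<star> G" for a
    using rdvd_sres_row[OF dvd] by (simp add: rdvd_def)
  then obtain F where F: "\<And>a. sres_row P Q k a = F a \<star> G" by metis
  have Fz: "coeff (F a) j = 0" if "a < ?N" "degree P + degree Q - k - degree G \<le> j" for a j
  proof (cases "F a = 0")
    case False
    have "degree (F a) + degree G < degree P + degree Q - k"
      using degree_sres_row[OF kn(1,2) that(1)] unfolding F degree_dmult[OF False G0] .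
    then show ?thesis using that by (intro coeff_eq_0) simp
  qed simp
  have "degree P + degree Q - k - degree G < ?N" using k kn by linarith
  then have "\<exists>v. (\<exists>a<?N. v a \<noteq> 0) \<and> (\<Sum>a<?N. smult (v a) (F a)) = 0"
    by (rule exists_dop_dependence) (rule Fz)
  then obtain v where v: "\<exists>a<?N. v a \<noteq> 0" "(\<Sum>a<?N. smult (v a) (F a)) = 0"
    by blast
  have "(\<Sum>a<?N. smult (v a) (sres_row P Q k a)) = (\<Sum>a<?N. smult (v a) (F a)) \<star> G"
    unfolding F by (simp add: dmult_sum_left dmult_smult_left)
  then have "(\<Sum>a<?N. smult (v a) (sres_row P Q k a)) = 0" using v(2) by simp
  then have "det (sres_mat_i P Q k i) = 0" for i
    unfolding sres_mat_i_eq[OF kn(1,2)] det_coeff_mat_eq_0_iff using v(1) by (intro exI[of _ v]) simp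
  then show ?thesis by (simp add: dsubres_def)
qed

lemma coeff_dsubres: "coeff (dsubres P Q k) i = (if i \<le> k then det (sres_mat_i P Q k i) else 0)"
  by (simp add: dsubres_def coeff_sum)

text \<open>By column expansion the subresultant is a combination of rows, hence a left multiple of
  \<open>G\<close>, and its order is at most that of \<open>G\<close>. Its top coefficient is
  nonzero, as a singular matrix would give a syzygy excluded by
  \<open>syzygy_degree_ge\<close>.\<close>

lemma dsubres_gcrd:
  assumes G: "bezout_gcrd G P Q" and d: "degree G < degree P" "degree G < degree Q"
  obtains c where "c \<noteq> 0" "dsubres P Q (degree G) = smult c G"
proof -
  have dvd: "rdvd G P" "rdvd G Q" and G0: "G \<noteq> 0" using G by (auto simp: bezout_gcrd_def)
  have P: "P \<noteq> 0" using d by auto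
  let ?d = "degree G" and ?M = "degree P + degree Q"
  let ?N = "?M - 2 * ?d"
  let ?g = "\<lambda>c. ?M - 1 - ?d - c"
  have N: "?N > 0" using d by simp
  obtain w where w: "\<And>i. det (sres_mat_i P Q ?d i) = coeff (\<Sum>a<?N. smult (w a) (sres_row P Q ?d a)) i"
    using det_last_column_coeff[OF N, of "sres_row P Q ?d" ?g] unfolding sres_mat_i_eq[OF d] by blast
  have row: "rdvd G (\<Sum>a<?N. smult (u a) (sres_row P Q ?d a))" for u
    by (intro rdvd_sum rdvd_smult rdvd_sres_row dvd)
  have high: "coeff (\<Sum>a<?N. smult (u a) (sres_row P Q ?d a)) i = 0" if "i \<ge> ?M - ?d" for i u
    unfolding coeff_sum coeff_smult
  proof (intro sum.neutral ballI)
    fix a assume "a \<in> {..<?N}"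
    then have "degree (sres_row P Q ?d a) < i" using degree_sres_row[OF d, of a] that by simp
    then show "u a * coeff (sres_row P Q ?d a) i = 0" by (simp add: coeff_eq_0)
  qed
  have S: "dsubres P Q ?d = (\<Sum>a<?N. smult (w a) (sres_row P Q ?d a))"
  proof (rule poly_eqI)
    fix i
    \<comment> \<open>For these \<open>i\<close> the last column repeats the earlier column of
      \<partial>^i; beyond this range every row has coefficient zero.\<close>
    have "det (sres_mat_i P Q ?d i) = 0" if "i > ?d" "i < ?M - ?d"
    proof (rule det_identical_columns)
      show "sres_mat_i P Q ?d i \<in> carrier_mat ?N ?N" by (simp add: sres_mat_i_eq[OF d])
      show "?M - 1 - ?d - i \<noteq> ?N - 1" "?M - 1 - ?d - i < ?N" "?N - 1 < ?N" using that N d by auto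
      show "col (sres_mat_i P Q ?d i) (?M - 1 - ?d - i) = col (sres_mat_i P Q ?d i) (?N - 1)"
        using that N d by (intro eq_vecI) (auto simp: sres_mat_i_eq[OF d])
    qed
    then show "coeff (dsubres P Q ?d) i = coeff (\<Sum>a<?N. smult (w a) (sres_row P Q ?d a)) i"
      using high[where ?i = i and ?u = w] w[of i] unfolding coeff_dsubres by force
  qed
  have "coeff (dsubres P Q ?d) ?d \<noteq> 0"
  proof
    assume "coeff (dsubres P Q ?d) ?d = 0"
    then have "det (sres_mat_i P Q ?d ?d) = 0" by (simp add: coeff_dsubres)
    then obtain v where v: "\<exists>a<?N. v a \<noteq> 0"
      and z: "\<And>c. c < ?N \<Longrightarrow> coeff (\<Sum>a<?N. smult (v a) (sres_row P Q ?d a)) (if c < ?N - 1 then ?g c else ?d) = 0"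
      unfolding sres_mat_i_eq[OF d] det_coeff_mat_eq_0_iff by blast
    define T where "T = (\<Sum>a<?N. smult (v a) (sres_row P Q ?d a))"
    have "coeff T i = 0" if i: "i \<ge> ?d" for i
    proof -
      consider "i = ?d" | "i \<ge> ?M - ?d" | "i > ?d" "i < ?M - ?d" using i by linarith
      then show ?thesis
      proof cases
        case 1
        then show ?thesis using z[of "?N - 1"] N by (simp add: T_def)
      next
        case 2
        then show ?thesis unfolding T_def by (rule high)
      next
        case 3
        define c where "c = ?M - 1 - ?d - i"
        have "c < ?N" "c < ?N - 1" "?g c = i" using 3 d unfolding c_def by linarith+
        then show ?thesis using z[of c] by (simp add: T_def)
      qed
    qed
    \<comment> \<open>A left multiple of \<open>G\<close> of order below that of \<open>G\<close> is
      zero.\<close>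
    then have "T \<noteq> 0 \<Longrightarrow> degree T < ?d" by (meson leading_coeff_0_iff not_le)
    moreover have "T \<noteq> 0 \<Longrightarrow> ?d \<le> degree T"
      unfolding T_def by (rule rdvd_degree_le[OF row])
    ultimately have T0: "T = 0" by linarith
    obtain A B where AB: "T = A \<star> P + B \<star> Q" "\<And>i. degree P - ?d \<le> i \<Longrightarrow> coeff B i = 0"
      "\<And>a. A = 0 \<Longrightarrow> B = 0 \<Longrightarrow> a < ?N \<Longrightarrow> v a = 0"
      using sres_row_combination[OF less_imp_le[OF d(1)] less_imp_le[OF d(2)], of v]
      unfolding T_def by blast
    have "B = 0"
    proof (rule ccontr)
      assume B: "B \<noteq> 0"
      have "B \<star> Q = (- A) \<star> P" using AB(1) T0 by (simp add: dmult_distribs eq_neg_iff_add_eq_0 add.commute)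
      then have "rdvd P (B \<star> Q)" unfolding rdvd_def by blast
      from syzygy_degree_ge[OF G P B this] have "coeff B (degree B) = 0" by (intro AB(2)) simp
      then show False using B by simp
    qed
    moreover from this have "A = 0" using AB(1) T0 P by simp
    ultimately show False using AB(3) v by blast
  qed
  moreover have "degree (dsubres P Q ?d) \<le> ?d" by (intro degree_le) (simp add: coeff_dsubres)
  ultimately have nz: "dsubres P Q ?d \<noteq> 0" and deg: "degree (dsubres P Q ?d) = ?d"
    by (auto intro: antisym le_degree)
  obtain F where F: "dsubres P Q ?d = F \<star> G" using row[of w] unfolding S[symmetric] rdvd_def by blast
  then have "F \<noteq> 0" using nz by auto
  then have "degree F = 0" using deg degree_dmult[OF _ G0, of F] F by simp
  then obtain c where "F = [:c:]" by (rule degree_eq_zeroE)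
  then show ?thesis using that[of c] F \<open>F \<noteq> 0\<close> by simp
qed

text \<open>For \<open>k = 0\<close> no column is deleted, so the resultant is the subresultant of
  index 0, a nonzero multiple of \<open>G\<close> when \<open>G\<close> has order 0.\<close>

lemma degree_gcrd_pos:
  assumes G: "bezout_gcrd G P Q" and d: "degree P > 0" "degree Q > 0" and res: "dres P Q = 0"
  shows "degree G > 0"
proof (rule ccontr)
  assume "\<not> ?thesis"
  then have G0: "degree G = 0" by simp
  have "sres_mat P Q 0 = sres_mat_i P Q 0 0"
    using d by (intro eq_matI) (auto simp: sres_mat_def sres_mat_i_def Let_def dord_def)
  then have "coeff (dsubres P Q 0) 0 = 0" using res by (simp add: coeff_dsubres dres_def)
  moreover obtain c where "c \<noteq> 0" "dsubres P Q 0 = smult c G"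
    using dsubres_gcrd[OF G] d G0 by metis
  ultimately show False using G G0 by (auto simp: bezout_gcrd_def elim: degree_eq_zeroE)
qed

subsection \<open>The resultant as a characteristic polynomial\<close>

text \<open>The determinant of \<open>N\<close> operators of order below \<open>N\<close> in the
  powers of \<partial>, highest first as in \<open>sres_mat\<close>.\<close>

definition cdet :: "nat \<Rightarrow> (nat \<Rightarrow> dop) \<Rightarrow> rf" where
  "cdet N X = det (mat N N (\<lambda>(a, c). coeff (X a) (N - 1 - c)))"

lemma cdet_mult:
  assumes A: "A \<in> carrier_mat N N" and X: "\<And>a. a < N \<Longrightarrow> X a = (\<Sum>b<N. smult (A $$ (a, b)) (Y b))"
  shows "cdet N X = det A * cdet N Y"
proof -
  let ?Y = "mat N N (\<lambda>(a, c). coeff (Y a) (N - 1 - c))"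
  have "mat N N (\<lambda>(a, c). coeff (X a) (N - 1 - c)) = A * ?Y"
    using A by (intro eq_matI) (auto simp: X coeff_sum scalar_prod_def lessThan_atLeast0)
  moreover have "?Y \<in> carrier_mat N N" by simp
  ultimately show ?thesis unfolding cdet_def using det_mult[OF A, of ?Y] by simp
qed

lemma cdet_triangular_nonzero:
  assumes "\<And>a. a < N \<Longrightarrow> X a \<noteq> 0 \<and> degree (X a) = N - 1 - a"
  shows "cdet N X \<noteq> 0"
proof -
  let ?X = "mat N N (\<lambda>(a, c). coeff (X a) (N - 1 - c))"
  have "upper_triangular ?X" using assms by (auto simp: upper_triangular_def intro!: coeff_eq_0)
  then have "det ?X = prod_list (diag_mat ?X)" by (rule det_upper_triangular[of _ N]) simp
  moreover have "0 \<notin> set (diag_mat ?X)"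
  proof
    assume "0 \<in> set (diag_mat ?X)"
    then obtain a where "a < N" "coeff (X a) (N - 1 - a) = 0" by (auto simp: diag_mat_def)
    then show False using assms[of a] by (metis leading_coeff_0_iff)
  qed
  ultimately show ?thesis by (simp add: cdet_def prod_list_zero_iff)
qed

lemma dmult_eq_sum_lessThan:
  assumes "\<And>j. n \<le> j \<Longrightarrow> coeff A j = 0"
  shows "A \<star> B = (\<Sum>i<n. smult (coeff A (n - 1 - i)) ((dX ^^ (n - 1 - i)) B))"
proof -
  have "A = (\<Sum>i<n. monom (coeff A i) i)"
    using assms by (intro poly_eqI) (auto simp: coeff_sum_monom)
  then have "A \<star> B = (\<Sum>i<n. smult (coeff A i) ((dX ^^ i) B))"
    using sum_monom_dmult[of "coeff A" n B] by simp
  also have "\<dots> = (\<Sum>i<n. smult (coeff A (n - Suc i)) ((dX ^^ (n - Suc i)) B))"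
    by (rule sum.nat_diff_reindex[symmetric])
  finally show ?thesis by simp
qed

lemma degree_dshift: "degree Q > 0 \<Longrightarrow> degree (dshift Q t) = degree Q"
  unfolding dshift_def by (subst diff_conv_add_uminus, rule degree_add_eq_left) simp

lemma dmult_dshift: "A \<star> dshift Q t = A \<star> Q - smult (cst t) A"
  by (simp add: dshift_def dmult_diff_right)

text \<open>\<open>A\<close> is the matrix, in the basis \<open>e\<close>, of right multiplication
  by \<open>Q\<close> modulo left multiples of \<open>P\<close>. Base changes with determinants
  independent of \<open>t\<close> bring the resultant to block triangular form with diagonal block
  \<open>A - t\<close>.\<close>

lemma dres_eq_det_char_matrix:
  assumes n: "degree P = n" "n > 0" and m: "degree Q = m" "m > 0"
    and e: "\<And>a. a < n \<Longrightarrow> e a \<noteq> 0 \<and> degree (e a) = n - 1 - a"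
    and C: "\<And>a j. a < n \<Longrightarrow> m \<le> j \<Longrightarrow> coeff (C a) j = 0"
    and A: "A \<in> carrier_mat n n"
    and eQ: "\<And>a. a < n \<Longrightarrow> e a \<star> Q = C a \<star> P + (\<Sum>b<n. smult (A $$ (a, b)) (e b))"
  obtains \<kappa> where "\<kappa> \<noteq> 0" "\<And>t. dres P (dshift Q t) = \<kappa> * det (char_matrix A (cst t))"
proof -
  let ?p = "\<lambda>a. (dX ^^ (m - 1 - a)) P"
  \<comment> \<open>The orders in \<open>Y\<close> run from \<open>m + n - 1\<close> down to 0, so
    its coefficient matrix is triangular.\<close>
  define Y where "Y = (\<lambda>a. if a < m then ?p a else e (a - m))"
  define T where "T = mat n n (\<lambda>(a, b). coeff (e a) (n - 1 - b))"
  have P0: "P \<noteq> 0" using n by auto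
  have T: "det T \<noteq> 0" using cdet_triangular_nonzero[of n e] e by (simp add: cdet_def T_def)
  have "cdet (m + n) Y \<noteq> 0"
  proof (rule cdet_triangular_nonzero)
    fix a assume a: "a < m + n"
    show "Y a \<noteq> 0 \<and> degree (Y a) = m + n - 1 - a"
    proof (cases "a < m")
      case True
      then show ?thesis using degree_dX_iter[OF P0, of "m - 1 - a"] n m by (simp add: Y_def)
    next
      case False
      then show ?thesis using e[of "a - m"] a by (simp add: Y_def)
    qed
  qed
  moreover have "dres P (dshift Q t) = cdet (m + n) Y / det T * det (char_matrix A (cst t))" for t
  proof -
    let ?Q = "dshift Q t"
    have dQ: "degree ?Q = m" using degree_dshift[of Q t] m by simp
    define X where "X = (\<lambda>a. if a < m then ?p a else (dX ^^ (n - 1 - (a - m))) ?Q)"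
    \<comment> \<open>\<open>X'\<close> is expressed twice: through the rows \<open>X\<close> of the
      resultant, by the base change \<open>T\<close>, and through \<open>Y\<close>, by division by
      \<open>P\<close>.\<close>
    define X' where "X' = (\<lambda>a. if a < m then ?p a else e (a - m) \<star> ?Q)"
    have "dres P ?Q = cdet (m + n) X"
      unfolding dres_def cdet_def
      by (intro arg_cong[of _ _ det] eq_matI)
         (auto simp: sres_mat_def sres_row_def Let_def dord_def dQ n dpow_mult_eq X_def add.commute)
    define U where "U = four_block_mat (1\<^sub>m m) (0\<^sub>m m n) (0\<^sub>m n m) T"
    have U: "U \<in> carrier_mat (m + n) (m + n)" by (simp add: U_def T_def)
    have "cdet (m + n) X' = det U * cdet (m + n) X"
    proof (rule cdet_mult[OF U])
      fix a assume a: "a < m + n"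
      show "X' a = (\<Sum>b<m + n. smult (U $$ (a, b)) (X b))"
      proof (cases "a < m")
        case True
        have "(\<Sum>b<m + n. smult (U $$ (a, b)) (X b)) = (\<Sum>b<m + n. if b = a then X a else 0)"
          using True by (intro sum.cong) (auto simp: U_def T_def)
        then show ?thesis using True by (simp add: X_def X'_def)
      next
        case False
        define a' where "a' = a - m"
        have a': "a = m + a'" "a' < n" using False a by (auto simp: a'_def)
        have "e a' \<star> ?Q = (\<Sum>i<n. smult (coeff (e a') (n - 1 - i)) ((dX ^^ (n - 1 - i)) ?Q))"
          using e[OF a'(2)] a' by (intro dmult_eq_sum_lessThan coeff_eq_0) auto
        then show ?thesis using a'
          by (simp add: sum_lessThan_add X_def X'_def U_def T_def)
      qed
    qed
    moreover have "det U = det T"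
      unfolding U_def by (subst det_four_block_mat_upper_right_zero[of _ m _ n]) (auto simp: T_def)
    moreover have "cdet (m + n) X' = det (char_matrix A (cst t)) * cdet (m + n) Y"
    proof -
      define D where "D = mat n m (\<lambda>(a, b). coeff (C a) (m - 1 - b))"
      have dc: "dim_row (char_matrix A (cst t)) = n" "dim_col (char_matrix A (cst t)) = n"
        using A by (simp_all add: char_matrix_def)
      \<comment> \<open>The quotients \<open>C\<close> fill the block below the diagonal, the
        remainders shifted by \<open>t\<close> the lower right one.\<close>
      define V where "V = four_block_mat (1\<^sub>m m) (0\<^sub>m m n) D (char_matrix A (cst t))"
      have V: "V \<in> carrier_mat (m + n) (m + n)" using A by (simp add: V_def D_def)
      have "cdet (m + n) X' = det V * cdet (m + n) Y"
      proof (rule cdet_mult[OF V])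
        fix a assume a: "a < m + n"
        show "X' a = (\<Sum>b<m + n. smult (V $$ (a, b)) (Y b))"
        proof (cases "a < m")
          case True
          have "(\<Sum>b<m + n. smult (V $$ (a, b)) (Y b)) = (\<Sum>b<m + n. if b = a then Y a else 0)"
            using True by (intro sum.cong) (auto simp: V_def D_def dc)
          then show ?thesis using True by (simp add: Y_def X'_def)
        next
          case False
          define a' where "a' = a - m"
          have a': "a = m + a'" "a' < n" using False a by (auto simp: a'_def)
          have c: "C a' \<star> P = (\<Sum>i<m. smult (coeff (C a') (m - 1 - i)) (?p i))"
            using C[OF a'(2)] by (rule dmult_eq_sum_lessThan)
          have ch: "char_matrix A (cst t) $$ (a', b) = A $$ (a', b) - (if b = a' then cst t else 0)" if "b < n" for b
            using that a' A by (auto simp: char_matrix_def)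
          have "(\<Sum>b<n. smult (char_matrix A (cst t) $$ (a', b)) (e b))
            = (\<Sum>b<n. smult (A $$ (a', b)) (e b) - (if b = a' then smult (cst t) (e a') else 0))"
            by (intro sum.cong) (auto simp: ch smult_diff_left)
          also have "\<dots> = (\<Sum>b<n. smult (A $$ (a', b)) (e b)) - smult (cst t) (e a')"
            using a' by (simp add: sum_subtractf)
          finally have "e a' \<star> ?Q = (\<Sum>i<m. smult (coeff (C a') (m - 1 - i)) (?p i)) +
             (\<Sum>b<n. smult (char_matrix A (cst t) $$ (a', b)) (e b))"
            by (simp add: dmult_dshift eQ[OF a'(2)] c)
          then show ?thesis using a' A
            by (simp add: sum_lessThan_add Y_def X'_def V_def D_def dc)
        qed
      qed
      moreover have "det V = det (char_matrix A (cst t))"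
        unfolding V_def using A by (subst det_four_block_mat_upper_right_zero[of _ m _ n]) (auto simp: D_def)
      ultimately show ?thesis by simp
    qed
    ultimately show ?thesis using T \<open>dres P ?Q = cdet (m + n) X\<close> by (simp add: field_simps)
  qed
  ultimately show ?thesis using T by (intro that[of "cdet (m + n) Y / det T"]) auto
qed

text \<open>In the basis \<open>\<partial>\<^sup>i G\<close>, \<open>\<partial>\<^sup>j\<close> (\<open>j < degree G\<close>) of operators modulo \<open>P\<close>, right multiplication
  by \<open>Q\<close> has image in the span of the \<open>\<partial>\<^sup>i G\<close>; \<open>\<chi>\<close> is its characteristic polynomial on that span.\<close>
lemma dres_eq_power_char_poly:
  assumes G: "bezout_gcrd G P Q" and n: "degree P > 0" and m: "degree Q > 0"
  obtains \<kappa> \<chi> where "\<kappa> \<noteq> 0" "degree \<chi> = degree P - degree G" "\<chi> \<noteq> 0"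
    "\<And>t. dres P (dshift Q t) = \<kappa> * cst t ^ degree G * poly \<chi> (cst t)"
    "(\<And>A. rdvd G A \<Longrightarrow> rdvd P (A \<star> Q) \<Longrightarrow> rdvd P A) \<Longrightarrow> poly \<chi> 0 \<noteq> 0"
proof -
  define N where "N = degree P"
  define d where "d = degree G"
  define q where "q = N - d"
  have P0: "P \<noteq> 0" and Q0: "Q \<noteq> 0" using n m by auto
  have G0: "G \<noteq> 0" and dvd: "rdvd G P" "rdvd G Q" using G by (auto simp: bezout_gcrd_def)
  have dN: "d \<le> N" using rdvd_degree_le[OF dvd(1) P0] by (simp add: d_def N_def)
  have qd: "N = q + d" using dN by (simp add: q_def)
  \<comment> \<open>Left multiples of \<open>G\<close> cover the orders \<open>N - 1\<close> to
    \<open>d\<close>, powers of \<partial> those below \<open>d\<close>, so that \<open>e a\<close>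
    has order \<open>N - 1 - a\<close>.\<close>
  define e where "e = (\<lambda>a. if a < q then (dX ^^ (q - 1 - a)) G else (dX ^^ (N - 1 - a)) 1)"
  have e: "e a \<noteq> 0 \<and> degree (e a) = N - 1 - a" if "a < N" for a
    using degree_dX_iter[OF G0, of "q - 1 - a"] degree_dX_iter[of 1 "N - 1 - a"] that qd
    by (auto simp: e_def d_def)
  have "\<exists>C F. e a \<star> Q = C \<star> P + F \<star> G \<and> (\<forall>j\<ge>degree Q. coeff C j = 0) \<and> (\<forall>j\<ge>q. coeff F j = 0)" if a: "a < N" for a
  proof -
    obtain C R where CR: "e a \<star> Q = C \<star> P + R" "R = 0 \<or> degree R < degree P"
      using right_division[OF P0] by blast
    have "R = e a \<star> Q - C \<star> P" using CR by simp
    then have "rdvd G R" using dvd by (auto intro!: rdvd_diff rdvd_dmult)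
    then obtain F where F: "R = F \<star> G" unfolding rdvd_def by blast
    have "coeff F j = 0" if "j \<ge> q" for j
    proof (cases "F = 0")
      case False
      then have "degree F + d < N" using CR(2) degree_dmult[OF False G0] G0 by (simp add: F N_def d_def)
      then show ?thesis using that qd by (intro coeff_eq_0) simp
    qed simp
    moreover have "coeff C j = 0" if "j \<ge> degree Q" for j
    proof (cases "C = 0")
      case False
      have eq: "degree (e a \<star> Q) < N + degree Q" using e[OF a] Q0 a by (simp add: degree_dmult)
      have "C \<star> P = e a \<star> Q - R" using CR by simp
      moreover have "degree R < N + degree Q" using CR(2) m n by (auto simp: N_def)
      ultimately have "degree (C \<star> P) < N + degree Q" using eq by (simp add: degree_diff_less)
      then have "degree C < degree Q" using degree_dmult[OF False P0] by (simp add: N_def)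
      then show ?thesis using that by (intro coeff_eq_0) simp
    qed simp
    ultimately show ?thesis
      using CR(1) F by (intro exI[of _ C] exI[of _ F]) simp
  qed
  then have "\<exists>C F. \<forall>a<N. e a \<star> Q = C a \<star> P + F a \<star> G \<and> (\<forall>j\<ge>degree Q. coeff (C a) j = 0) \<and> (\<forall>j\<ge>q. coeff (F a) j = 0)"
    by metis
  then obtain C F where eQ: "\<And>a. a < N \<Longrightarrow> e a \<star> Q = C a \<star> P + F a \<star> G"
    and C: "\<And>a j. a < N \<Longrightarrow> degree Q \<le> j \<Longrightarrow> coeff (C a) j = 0"
    and F: "\<And>a j. a < N \<Longrightarrow> q \<le> j \<Longrightarrow> coeff (F a) j = 0"
    by blast
  define A1 where "A1 = mat q q (\<lambda>(a, b). coeff (F a) (q - 1 - b))"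
  define A where "A = mat N N (\<lambda>(a, b). if b < q then coeff (F a) (q - 1 - b) else 0)"
  have FG: "F a \<star> G = (\<Sum>b<q. smult (coeff (F a) (q - 1 - b)) (e b))" if "a < N" for a
  proof -
    have "F a \<star> G = (\<Sum>b<q. smult (coeff (F a) (q - 1 - b)) ((dX ^^ (q - 1 - b)) G))"
      using F[OF that] by (rule dmult_eq_sum_lessThan)
    then show ?thesis by (simp add: e_def)
  qed
  have Ac: "A \<in> carrier_mat N N" by (simp add: A_def)
  have eA: "e a \<star> Q = C a \<star> P + (\<Sum>b<N. smult (A $$ (a, b)) (e b))" if "a < N" for a
    using that unfolding eQ[OF that] FG[OF that]
    by (simp add: qd sum_lessThan_add A_def)
  obtain \<kappa> where \<kappa>: "\<kappa> \<noteq> 0" "\<And>t. dres P (dshift Q t) = \<kappa> * det (char_matrix A (cst t))"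
    using dres_eq_det_char_matrix[OF N_def[symmetric] _ refl m e C Ac eA] n N_def by metis
  have A1: "A1 \<in> carrier_mat q q" by (simp add: A1_def)
  \<comment> \<open>All remainders are left multiples of \<open>G\<close>, so the last
    \<open>d\<close> columns of \<open>A\<close> vanish and contribute \<open>t^d\<close> up to
    sign.\<close>
  have ch: "det (char_matrix A (cst t)) = (-1) ^ N * (cst t ^ d * poly (char_poly A1) (cst t))" for t
  proof -
    let ?S = "mat d q (\<lambda>(a, b). coeff (F (q + a)) (q - 1 - b))"
    have "char_matrix A (cst t) = four_block_mat (char_matrix A1 (cst t)) (0\<^sub>m q d) ?S ((- cst t) \<cdot>\<^sub>m 1\<^sub>m d)"
      by (intro eq_matI) (auto simp: A_def A1_def char_matrix_def qd)
    then have "det (char_matrix A (cst t)) = det (char_matrix A1 (cst t)) * det ((- cst t) \<cdot>\<^sub>m (1\<^sub>m d :: rf mat))"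
      using A1 by (simp add: det_four_block_mat_upper_right_zero[of _ q _ d])
    moreover have "poly (char_poly A1) (cst t) = (-1) ^ q * det (char_matrix A1 (cst t))"
    proof -
      have "- char_matrix A1 (cst t) = (-1) \<cdot>\<^sub>m char_matrix A1 (cst t)"
        using A1 by (intro eq_matI) auto
      moreover have "dim_col (char_matrix A1 (cst t)) = q" using A1 by (simp add: char_matrix_def)
      ultimately show ?thesis by (simp add: char_poly_matrix[OF A1])
    qed
    moreover have "det ((- cst t) \<cdot>\<^sub>m (1\<^sub>m d :: rf mat)) = (-1) ^ d * cst t ^ d"
      by (simp add: power_minus[of "cst t"])
    ultimately show ?thesis
      by (simp add: qd power_add)
  qed
  \<comment> \<open>A left null vector of \<open>A1\<close> would give a nonzero left multiple
    \<open>B\<close> of \<open>G\<close>, of order below that of \<open>P\<close>, with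
    \<open>B Q\<close> a left multiple of \<open>P\<close>.\<close>
  have "poly (char_poly A1) 0 \<noteq> 0" if inj: "\<And>A. rdvd G A \<Longrightarrow> rdvd P (A \<star> Q) \<Longrightarrow> rdvd P A"
  proof
    assume "poly (char_poly A1) 0 = 0"
    then have "det (char_matrix A1 0) = 0"
      using A1 det_0_negate[of "char_matrix A1 0" q] by (simp add: char_poly_matrix[OF A1])
    moreover have "char_matrix A1 0 = A1" using A1 by (intro eq_matI) (auto simp: char_matrix_def)
    ultimately have "det (transpose_mat A1) = 0" by (simp add: det_transpose[OF A1])
    then obtain v where v: "v \<in> carrier_vec q" "v \<noteq> 0\<^sub>v q" "transpose_mat A1 *\<^sub>v v = 0\<^sub>v q"
      using det_0_iff_vec_prod_zero_field[of "transpose_mat A1" q] A1 by auto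
    have vz: "(\<Sum>a<q. v $ a * coeff (F a) (q - 1 - b)) = 0" if "b < q" for b
    proof -
      have "(transpose_mat A1 *\<^sub>v v) $ b = 0" using v(3) that by simp
      then show ?thesis using that v(1)
        by (simp add: A1_def scalar_prod_def lessThan_atLeast0 mult.commute)
    qed
    define B where "B = (\<Sum>a<q. smult (v $ a) (e a))"
    have "(\<Sum>a<q. smult (v $ a) (F a)) = 0"
    proof (rule poly_eqI)
      fix j
      show "coeff (\<Sum>a<q. smult (v $ a) (F a)) j = coeff 0 j"
      proof (cases "j < q")
        case True
        then show ?thesis using vz[of "q - 1 - j"] by (simp add: coeff_sum)
      qed (use F qd in \<open>simp add: coeff_sum\<close>)
    qed
    moreover have "B \<star> Q = (\<Sum>a<q. smult (v $ a) (C a)) \<star> P + (\<Sum>a<q. smult (v $ a) (F a)) \<star> G"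
      using qd by (simp add: B_def dmult_sum_left dmult_smult_left eQ smult_add_right sum.distrib)
    ultimately have PBQ: "rdvd P (B \<star> Q)" unfolding rdvd_def by auto
    have BG: "B = (\<Sum>i<q. monom (v $ (q - 1 - i)) i) \<star> G"
      unfolding B_def sum_monom_dmult
      by (subst sum.nat_diff_reindex[symmetric]) (auto simp: e_def intro!: sum.cong)
    have "rdvd G B" unfolding BG by (rule rdvd_dmult[OF rdvd_refl])
    then have "rdvd P B" using PBQ by (rule inj)
    obtain a where a: "a < q" "v $ a \<noteq> 0" using v(1,2) by (auto simp: vec_eq_iff)
    have "coeff (\<Sum>i<q. monom (v $ (q - 1 - i)) i) (q - 1 - a) \<noteq> 0"
      using a by (simp add: coeff_sum_monom)
    then have "B \<noteq> 0" using BG G0 by auto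
    have "degree B < degree P"
      unfolding B_def
      by (rule degree_sum_less) (use e qd n in \<open>auto simp: N_def[symmetric] intro: le_less_trans[OF degree_smult_le]\<close>)
    then show False using rdvd_degree_le[OF \<open>rdvd P B\<close> \<open>B \<noteq> 0\<close>] by simp
  qed
  moreover have "degree (char_poly A1) = degree P - degree G" "char_poly A1 \<noteq> 0"
    using degree_monic_char_poly[OF A1] by (auto simp: q_def N_def d_def)
  ultimately show ?thesis using \<kappa>
    by (intro that[of "\<kappa> * (-1) ^ N" "char_poly A1"]) (simp_all add: ch d_def mult.assoc)
qed

text \<open>Exchanging the operators rotates the rows, so \<epsilon> is a sign depending on the two
  orders alone and serves all shifts at once.\<close>

lemma dres_swap:
  obtains \<epsilon> where "\<epsilon> \<noteq> 0" "\<And>P Q. degree P = n \<Longrightarrow> degree Q = m \<Longrightarrow> dres Q P = \<epsilon> * dres P Q"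
proof -
  define p where "p = (\<lambda>a. if a < n then a + m else if a < n + m then a - n else a)"
  have p: "p permutes {0..<n + m}"
  proof (rule bij_imp_permutes)
    show "bij_betw p {0..<n + m} {0..<n + m}"
      by (rule bij_betw_byWitness[where f' = "\<lambda>a. if a < m then a + n else a - m"])
         (auto simp: p_def)
  qed (auto simp: p_def)
  have "dres Q P = signof p * dres P Q" if d: "degree P = n" "degree Q = m" for P Q
  proof -
    have "sres_mat Q P 0 = mat (n + m) (n + m) (\<lambda>(i, j). sres_mat P Q 0 $$ (p i, j))"
      by (intro eq_matI)
         (auto simp: sres_mat_def sres_row_def Let_def dord_def p_def d add.commute)
    moreover have "sres_mat P Q 0 \<in> carrier_mat (n + m) (n + m)"
      by (simp add: sres_mat_def dord_def Let_def d)
    ultimately show ?thesis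
      unfolding dres_def by (simp only: det_permute_rows[OF _ p])
  qed
  moreover have "(signof p :: rf) \<noteq> 0"
    by (auto simp: sign_def)
  ultimately show ?thesis using that[of "signof p"] by simp
qed

subsection \<open>Polynomials evaluated at commuting operators\<close>

lemma eval2_0 [simp]: "eval2 0 x y = 0"
  by (simp add: eval2_def)

lemma eval2_pCons [simp]: "eval2 (pCons a g) x y = poly a x + y * eval2 g x y"
  by (simp add: eval2_def Polynomial.map_poly_pCons)

lemma eval2_add [simp]: "eval2 (g + h) x y = eval2 g x y + eval2 h x y"
proof (induction g arbitrary: h)
  case (pCons a g)
  show ?case by (cases h) (simp add: pCons.IH, simp add: algebra_simps)
qed simp

lemma eval2_smult [simp]: "eval2 (smult a h) x y = poly a x * eval2 h x y"
  by (induction h) (auto simp: algebra_simps)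

lemma eval2_mult [simp]: "eval2 (g * h) x y = eval2 g x y * eval2 h x y"
  by (induction g) (auto simp: algebra_simps)

lemma dmu_0 [simp]: "dmu 0 = 0" and dlam_0 [simp]: "dlam 0 = 0"
  by (simp_all add: dmu_def dlam_def)

lemma dmu_pCons: "dmu (pCons a g) = g + pCons 0 (dmu g)"
  by (simp add: dmu_def pderiv_pCons)

lemma dlam_pCons: "dlam (pCons a g) = pCons (pderiv a) (dlam g)"
  by (simp add: dlam_def Polynomial.map_poly_pCons)

lemma dmu_add: "dmu (g + h) = dmu g + dmu h"
  by (simp add: dmu_def pderiv_add)

lemma dmu_smult: "dmu (smult a h) = smult a (dmu h)"
  by (simp add: dmu_def pderiv_smult)

lemma eval2_dmu: "eval2 (dmu h) x y = poly (pderiv (map_poly (\<lambda>p. poly p x) h)) y"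
  by (induction h) (auto simp: dmu_pCons Polynomial.map_poly_pCons pderiv_pCons eval2_def[symmetric])

text \<open>Reduces a nonzero lambda-derivative to a nonzero mu-derivative for the exchanged
  pair.\<close>

lemma swap_variables:
  obtains h' where "\<And>x y. eval2 h' y x = eval2 h x y" "\<And>x y. eval2 (dmu h') y x = eval2 (dlam h) x y"
proof -
  have lift: "eval2 (map_poly (\<lambda>c. [:c:]) a) y x = poly a x \<and>
      eval2 (dmu (map_poly (\<lambda>c. [:c:]) a)) y x = poly (pderiv a) x" for a x y
    by (induction a) (auto simp: Polynomial.map_poly_pCons dmu_pCons pderiv_pCons)
  have "\<exists>h'. (\<forall>x y. eval2 h' y x = eval2 h x y) \<and> (\<forall>x y. eval2 (dmu h') y x = eval2 (dlam h) x y)"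
  proof (induction h)
    case (pCons a g)
    then obtain g' where g': "\<forall>x y. eval2 g' y x = eval2 g x y" "\<forall>x y. eval2 (dmu g') y x = eval2 (dlam g) x y"
      by blast
    show ?case
      \<comment> \<open>The coefficient \<open>a\<close> moves to the outer variable; the former
        outer variable becomes the coefficient \<open>[:0, 1:]\<close>.\<close>
      by (intro exI[of _ "map_poly (\<lambda>c. [:c:]) a + smult [:0, 1:] g'"])
         (simp add: lift g' dmu_add dmu_smult dlam_pCons)
  qed (intro exI[of _ 0], simp)
  then show ?thesis using that by blast
qed

section \<open>Values of polynomials in the operators modulo \<open>L - x\<close>\<close>

lemma dmult_dshift_left: "dshift Q t \<star> A = Q \<star> A - smult (cst t) A"
  by (simp add: dshift_def dmult_diff_left)

lemma dshift_commute:
  assumes "A \<star> B = B \<star> A"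
  shows "dshift A x \<star> B = B \<star> dshift A x"
  by (simp add: dmult_dshift dmult_dshift_left assms)

text \<open>\<open>Z\<close> is \<open>a(L)\<close>, built by Horner's scheme and independent of
  \<open>x\<close>.\<close>

lemma exists_operator_value:
  "\<exists>Z. \<forall>x. rdvd (dshift L x) (Z - [:cst (poly a x):])"
proof (induction a)
  case (pCons c a)
  then obtain Z where Z: "\<And>x. rdvd (dshift L x) (Z - [:cst (poly a x):])" by blast
  have "[:cst c:] + L \<star> Z - [:cst (poly (pCons c a) x):]
      = L \<star> (Z - [:cst (poly a x):]) + smult (cst (poly a x)) (dshift L x)" for x
    by (simp add: dmult_diff_right dshift_def smult_diff_right mult.commute)
  then show ?case
    using Z by (intro exI[of _ "[:cst c:] + L \<star> Z"]) (auto intro!: rdvd_add rdvd_dmult rdvd_smult)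
qed (intro exI[of _ 0], simp)

text \<open>The operator \<open>Z = h(L, M)\<close>, through its first-order Taylor expansion in \<open>M - y\<close> modulo \<open>L - x\<close>.\<close>
lemma exists_operator_value2:
  assumes comm: "L \<star> M = M \<star> L"
  shows "\<exists>Z. \<forall>x y. \<exists>W. W \<star> L = L \<star> W \<and> W \<star> M = M \<star> W \<and>
     rdvd (dshift L x) (Z - [:cst (eval2 h x y):] - smult (cst (eval2 (dmu h) x y)) (dshift M y)
        - W \<star> (dshift M y \<star> dshift M y))"
proof (induction h)
  case 0
  show ?case by (intro exI[of _ 0] allI) simp
next
  case (pCons a g)
  obtain Za where Za: "\<And>x. rdvd (dshift L x) (Za - [:cst (poly a x):])"
    using exists_operator_value by blast
  obtain Z where Z: "\<And>x y. \<exists>W. W \<star> L = L \<star> W \<and> W \<star> M = M \<star> W \<and>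
     rdvd (dshift L x) (Z - [:cst (eval2 g x y):] - smult (cst (eval2 (dmu g) x y)) (dshift M y)
        - W \<star> (dshift M y \<star> dshift M y))"
    using pCons.IH by blast
  show ?case
  proof (rule exI[of _ "Za + M \<star> Z"], intro allI)
    fix x y
    define g0 where "g0 = eval2 g x y"
    define g1 where "g1 = eval2 (dmu g) x y"
    define Q where "Q = dshift M y"
    obtain W where W: "W \<star> L = L \<star> W" "W \<star> M = M \<star> W"
      "rdvd (dshift L x) (Z - [:cst g0:] - smult (cst g1) Q - W \<star> (Q \<star> Q))"
      using Z unfolding g0_def g1_def Q_def by blast
    \<comment> \<open>The coefficient of \<open>Q^2\<close> in
      \<open>(y + Q) (g0 + g1 Q + W Q^2)\<close>, where \<open>M = y + Q\<close>.\<close>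
    define W' where "W' = [:cst g1:] + M \<star> W"
    have c: "W' \<star> L = L \<star> W'" "W' \<star> M = M \<star> W'"
      unfolding W'_def dmult_add_left dmult_add_right
      by (simp_all add: dmult_assoc W) (simp add: comm flip: dmult_assoc)
    have MQ: "M = [:cst y:] + Q" by (simp add: Q_def dshift_def)
    have "Za + M \<star> Z - [:cst (poly a x + y * g0):] - smult (cst (g0 + y * g1)) Q - W' \<star> (Q \<star> Q)
       = (Za - [:cst (poly a x):]) + M \<star> (Z - [:cst g0:] - smult (cst g1) Q - W \<star> (Q \<star> Q))
         + (smult (cst g0) M - [:cst (y * g0):] - smult (cst g0) Q)
         + (smult (cst g1) (M \<star> Q) - smult (cst (y * g1)) Q - smult (cst g1) (Q \<star> Q))"
      by (simp add: W'_def dmult_distribs dmult_assoc dmult_smult_cst_right smult_add_left algebra_simps)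
    also have "smult (cst g0) M - [:cst (y * g0):] - smult (cst g0) Q = 0"
      by (subst MQ) (simp add: smult_add_right mult.commute)
    also have "smult (cst g1) (M \<star> Q) - smult (cst (y * g1)) Q - smult (cst g1) (Q \<star> Q) = 0"
      by (subst MQ) (simp add: dmult_add_left smult_add_right mult.commute)
    finally have "Za + M \<star> Z - [:cst (poly a x + y * g0):] - smult (cst (g0 + y * g1)) Q - W' \<star> (Q \<star> Q)
       = (Za - [:cst (poly a x):]) + M \<star> (Z - [:cst g0:] - smult (cst g1) Q - W \<star> (Q \<star> Q))"
      by simp
    moreover have "rdvd (dshift L x) \<dots>" using Za W(3) by (intro rdvd_add rdvd_dmult)
    ultimately have "rdvd (dshift L x)
      (Za + M \<star> Z - [:cst (poly a x + y * g0):] - smult (cst (g0 + y * g1)) Q - W' \<star> (Q \<star> Q))"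
      by (simp only:)
    then show "\<exists>W. W \<star> L = L \<star> W \<and> W \<star> M = M \<star> W \<and>
       rdvd (dshift L x) (Za + M \<star> Z - [:cst (eval2 (pCons a g) x y):]
          - smult (cst (eval2 (dmu (pCons a g)) x y)) (dshift M y) - W \<star> (dshift M y \<star> dshift M y))"
      using c by (intro exI[of _ W']) (simp add: dmu_pCons g0_def g1_def Q_def)
  qed
qed

section \<open>Powers modulo a right factor, and polynomial identities tested on constants\<close>

definition dpower :: "dop \<Rightarrow> nat \<Rightarrow> dop" where
  "dpower A i = ((\<lambda>B. A \<star> B) ^^ i) 1"

lemma dpower_0 [simp]: "dpower A 0 = 1" and dpower_Suc [simp]: "dpower A (Suc i) = A \<star> dpower A i"
  by (simp_all add: dpower_def)

lemma rdvd_dpower_diff: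
  assumes "rdvd G (dshift A x)"
  shows "rdvd G (dpower A i - [:cst (x ^ i):])"
proof (induction i)
  case (Suc i)
  have "dpower A (Suc i) - [:cst (x ^ Suc i):]
      = A \<star> (dpower A i - [:cst (x ^ i):]) + smult (cst (x ^ i)) (dshift A x)"
    by (simp add: dmult_diff_right dshift_def smult_diff_right mult.commute del: cst_power)
  then show ?case using Suc assms by (auto intro!: rdvd_add rdvd_dmult rdvd_smult)
qed (simp add: one_pCons)

text \<open>The resultants are known at constant shifts only, but there are infinitely many of
  these.\<close>

lemma poly_eqI_on_cst:
  fixes p q :: "rf poly"
  assumes "\<And>t. poly p (cst t) = poly q (cst t)"
  shows "p = q"
proof (rule ccontr)
  assume "p \<noteq> q"
  then have "finite {z. poly (p - q) z = 0}" by (intro poly_roots_finite) simp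
  moreover have "range cst \<subseteq> {z. poly (p - q) z = 0}" using assms by auto
  ultimately have "finite (range cst)" by (rule rev_finite_subset)
  moreover have "inj cst" by (rule injI) simp
  ultimately show False using infinite_UNIV_char_0 finite_imageD by blast
qed

lemma poly_map_cst: "poly (map_poly cst p) (cst t) = cst (poly p t)"
  by (induction p) (auto simp: Polynomial.map_poly_pCons)

subsection \<open>The order of the greatest common right divisor\<close>

text \<open>The factor \<epsilon> admits the exchanged pair, whose resultant may differ by a
  sign.\<close>

locale spectral_resultant =
  fixes L M :: dop and h :: "complex poly poly" and s :: nat and \<epsilon> :: rf
  assumes comm: "L \<star> M = M \<star> L" and degL: "degree L > 0" and degM: "degree M > 0"
    and eps: "\<epsilon> \<noteq> 0"
    and res: "\<And>x y. dres (dshift L x) (dshift M y) = \<epsilon> * cst (eval2 h x y ^ s)"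
begin

text \<open>As a polynomial in \<open>t\<close> the resultant is a unit times
  \<open>t^(degree G)\<close> times a polynomial of degree \<open>degree L - degree G\<close>, so no
  degree is lost over any \<open>x\<close>.\<close>

lemma degree_fiber: "s * degree (map_poly (\<lambda>p. poly p x) h) = degree L"
proof -
  define w where "w = map_poly (\<lambda>p. poly p x) h"
  have P: "degree (dshift L x) = degree L" using degree_dshift degL by simp
  then have P0: "dshift L x \<noteq> 0" using degL by auto
  then obtain G where G: "bezout_gcrd G (dshift L x) M" by (rule bezout_gcrd_exists)
  have Gle: "degree G \<le> degree L"
    using G rdvd_degree_le[OF _ P0] P by (auto simp: bezout_gcrd_def)
  obtain \<kappa> \<chi> where \<kappa>: "\<kappa> \<noteq> 0" "degree \<chi> = degree (dshift L x) - degree G" "\<chi> \<noteq> 0"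
    "\<And>t. dres (dshift L x) (dshift M t) = \<kappa> * cst t ^ degree G * poly \<chi> (cst t)"
    using dres_eq_power_char_poly[OF G] P degL degM by metis
  have "smult \<kappa> (monom 1 (degree G) * \<chi>) = smult \<epsilon> (map_poly cst (w ^ s))"
    using \<kappa>(4) res[of x] by (intro poly_eqI_on_cst)
      (simp add: poly_monom poly_map_cst w_def eval2_def[symmetric] mult.assoc)
  moreover have "degree (smult \<kappa> (monom 1 (degree G) * \<chi>)) = degree L"
    using \<kappa> P Gle by (simp add: degree_mult_eq degree_monom_eq)
  moreover have "degree (smult \<epsilon> (map_poly cst (w ^ s))) = degree (w ^ s)"
    using eps by (simp add: degree_map_poly)
  moreover have "degree (w ^ s) = s * degree w"
    by (cases "w = 0") (simp_all add: degree_power_eq power_0_left)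
  ultimately show ?thesis by (simp add: w_def)
qed

lemma s_pos: "s > 0"
  using degree_fiber[of 0] degL by (cases s) auto

lemma point_over:
  obtains y where "eval2 h x y = 0"
proof -
  have "degree (map_poly (\<lambda>p. poly p x) h) \<noteq> 0" using degree_fiber[of x] degL by (metis mult_0_right less_irrefl)
  then have "\<not> constant (poly (map_poly (\<lambda>p. poly p x) h))"
    unfolding constant_degree .
  then obtain y where "poly (map_poly (\<lambda>p. poly p x) h) y = 0"
    using fundamental_theorem_of_algebra by blast
  then show ?thesis using that by (simp add: eval2_def)
qed

lemma common_right_factor:
  assumes "eval2 h x y = 0"
  obtains G where "degree G > 0" "rdvd G (dshift L x)" "rdvd G (dshift M y)"
proof -
  have d: "degree (dshift L x) > 0" "degree (dshift M y) > 0"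
    using degree_dshift degL degM by simp_all
  then have "dshift L x \<noteq> 0" by auto
  then obtain G where G: "bezout_gcrd G (dshift L x) (dshift M y)" by (rule bezout_gcrd_exists)
  have "dres (dshift L x) (dshift M y) = 0" using assms s_pos by (simp add: res)
  from degree_gcrd_pos[OF G d this] G show ?thesis by (intro that) (auto simp: bezout_gcrd_def)
qed

text \<open>An operator right-divisible by a factor of every \<open>L - x\<close> vanishes: modulo it, the powers of
  \<open>L\<close> would satisfy a linear relation over the rational functions, i.e. a polynomial with every
  constant as a root.\<close>
lemma eq_0_if_common_factors:
  assumes "\<And>x. \<exists>G. degree G > 0 \<and> rdvd G (dshift L x) \<and> rdvd G Z"
  shows "Z = 0"
proof (rule ccontr)
  assume Z0: "Z \<noteq> 0"
  define z where "z = degree Z"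
  have "\<forall>i. \<exists>C R. dpower L i = C \<star> Z + R \<and> (R = 0 \<or> degree R < degree Z)"
    using right_division[OF Z0] by blast
  then obtain C R where CR: "\<And>i. dpower L i = C i \<star> Z + R i" "\<And>i. R i = 0 \<or> degree (R i) < degree Z"
    by metis
  have Rz: "coeff (R i) j = 0" if "z \<le> j" for i j
    using CR(2)[of i] that by (auto simp: z_def intro: coeff_eq_0)
  have "\<exists>c. (\<exists>i<Suc z. c i \<noteq> 0) \<and> (\<Sum>i<Suc z. smult (c i) (R i)) = 0"
    by (rule exists_dop_dependence[of z]) (simp, rule Rz)
  then obtain c where c: "\<exists>i<Suc z. c i \<noteq> 0" "(\<Sum>i<Suc z. smult (c i) (R i)) = 0" by blast
  have "(\<Sum>i<Suc z. smult (c i) (dpower L i)) = (\<Sum>i<Suc z. smult (c i) (C i \<star> Z)) + (\<Sum>i<Suc z. smult (c i) (R i))"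
    unfolding CR(1) by (simp only: smult_add_right sum.distrib)
  then have eq: "(\<Sum>i<Suc z. smult (c i) (dpower L i)) = (\<Sum>i<Suc z. smult (c i) (C i \<star> Z))"
    using c(2) by simp
  define p where "p = (\<Sum>i<Suc z. monom (c i) i)"
  \<comment> \<open>Modulo \<open>G\<close> each \<open>L^i\<close> becomes \<open>x^i\<close>, so
    \<open>p(x)\<close> is a left multiple of \<open>G\<close>; having order 0, it vanishes.\<close>
  have "poly p (cst x) = poly 0 (cst x)" for x
  proof -
    obtain G where G: "degree G > 0" "rdvd G (dshift L x)" "rdvd G Z" using assms by blast
    have 1: "rdvd G (\<Sum>i<Suc z. smult (c i) (dpower L i))"
      unfolding eq by (intro rdvd_sum rdvd_smult rdvd_dmult G(3))
    have 2: "rdvd G (\<Sum>i<Suc z. smult (c i) (dpower L i - [:cst (x ^ i):]))"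
      by (intro rdvd_sum rdvd_smult rdvd_dpower_diff G(2))
    have "poly p (cst x) = (\<Sum>i<Suc z. c i * cst (x ^ i))"
      by (simp only: p_def poly_sum poly_monom cst_power)
    then have "[:poly p (cst x):] = (\<Sum>i<Suc z. smult (c i) [:cst (x ^ i):])"
      by (intro poly_eqI) (simp only: coeff_sum coeff_smult coeff_pCons split: nat.split, simp)
    then have "[:poly p (cst x):] = (\<Sum>i<Suc z. smult (c i) (dpower L i))
       - (\<Sum>i<Suc z. smult (c i) (dpower L i - [:cst (x ^ i):]))"
      by (simp only: smult_diff_right sum_subtractf) simp
    then have "rdvd G [:poly p (cst x):]" using rdvd_diff[OF 1 2] by simp
    then show ?thesis using rdvd_degree_le[of G "[:poly p (cst x):]"] G(1) by fastforce
  qed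
  then have "p = 0" by (rule poly_eqI_on_cst)
  then have "(if i < Suc z then c i else 0) = 0" for i
    using coeff_sum_monom[of c "Suc z" i] by (simp only: p_def coeff_0)
  then show False using c(1) by metis
qed

text \<open>As \<open>h(L, M) = 0\<close>, the Taylor expansion makes \<open>c Q + W Q^2\<close>
  with \<open>c \<noteq> 0\<close> a left multiple of \<open>P\<close>. Hence right multiplication
  by \<open>Q\<close> is injective on its own image modulo \<open>P\<close>, and
  \<open>degree G\<close> is the full multiplicity of the root.\<close>

lemma degree_gcrd_if_dmu_nonzero:
  assumes h0: "eval2 h x y = 0" and h1: "eval2 (dmu h) x y \<noteq> 0"
    and G: "bezout_gcrd G (dshift L x) (dshift M y)"
  shows "degree G = s"
proof -
  define P where "P = dshift L x"
  define Q where "Q = dshift M y"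
  note G = G[folded P_def Q_def]
  have P: "degree P = degree L" and Q: "degree Q = degree M"
    using degree_dshift degL degM by (simp_all add: P_def Q_def)
  have PQ: "P \<star> Q = Q \<star> P"
    unfolding P_def Q_def by (metis comm dshift_commute)
  obtain Z where Z: "\<And>x y. \<exists>W. W \<star> L = L \<star> W \<and> W \<star> M = M \<star> W \<and>
     rdvd (dshift L x) (Z - [:cst (eval2 h x y):] - smult (cst (eval2 (dmu h) x y)) (dshift M y)
        - W \<star> (dshift M y \<star> dshift M y))"
    using exists_operator_value2[OF comm] by blast
  \<comment> \<open>Over every \<open>x\<close> lies a point of the curve, whose common right factor
    divides every term of the expansion of \<open>Z\<close>.\<close>
  have "Z = 0"
  proof (rule eq_0_if_common_factors)
    fix x
    obtain y where y: "eval2 h x y = 0" by (rule point_over)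
    then obtain F where F: "degree F > 0" "rdvd F (dshift L x)" "rdvd F (dshift M y)"
      by (rule common_right_factor)
    obtain W where "rdvd (dshift L x) (Z - smult (cst (eval2 (dmu h) x y)) (dshift M y)
        - W \<star> (dshift M y \<star> dshift M y))" (is "rdvd _ ?T")
      using Z[of x y] y by auto
    then have "rdvd F ?T" using F(2) rdvd_trans by blast
    moreover have "Z = ?T + smult (cst (eval2 (dmu h) x y)) (dshift M y) + W \<star> (dshift M y \<star> dshift M y)"
      by simp
    ultimately have "rdvd F Z" using F(3) by (metis rdvd_add rdvd_smult rdvd_dmult)
    then show "\<exists>G. degree G > 0 \<and> rdvd G (dshift L x) \<and> rdvd G Z" using F by blast
  qed
  define c where "c = cst (eval2 (dmu h) x y)"
  have c: "c \<noteq> 0" using h1 by (simp add: c_def)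
  obtain W where W: "W \<star> L = L \<star> W" "W \<star> M = M \<star> W" and T: "rdvd P (- smult c Q - W \<star> (Q \<star> Q))"
    using Z[of x y] h0 \<open>Z = 0\<close> unfolding P_def Q_def c_def by auto
  have WP: "P \<star> W = W \<star> P" and WQ: "Q \<star> W = W \<star> Q"
    using W unfolding P_def Q_def by (metis dshift_commute)+
  \<comment> \<open>Modulo left multiples of \<open>P\<close>, \<open>A\<close> is
    \<open>B Q\<close>. If \<open>A Q\<close> vanishes there, so do \<open>B Q^2\<close> and, by
    commutation, \<open>B W Q^2\<close>; the relation \<open>T\<close> then leaves
    \<open>c B Q\<close>.\<close>
  have inj: "rdvd P A" if GA: "rdvd G A" and PAQ: "rdvd P (A \<star> Q)" for A
  proof -
    obtain F U V where "A = F \<star> G" "G = U \<star> P + V \<star> Q"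
      using GA G by (auto simp: rdvd_def bezout_gcrd_def)
    then have A: "A = (F \<star> U) \<star> P + (F \<star> V) \<star> Q" by (simp add: dmult_add_right dmult_assoc)
    define B where "B = F \<star> V"
    have "A \<star> Q = ((F \<star> U) \<star> Q) \<star> P + B \<star> (Q \<star> Q)"
      unfolding A B_def by (simp add: dmult_add_left dmult_assoc PQ)
    then have "B \<star> (Q \<star> Q) = A \<star> Q - ((F \<star> U) \<star> Q) \<star> P" by simp
    then have "rdvd P (B \<star> (Q \<star> Q))" using PAQ by (auto intro!: rdvd_diff rdvd_dmult[OF rdvd_refl])
    then have "rdvd P (B \<star> (Q \<star> Q) \<star> W)" using WP by (rule rdvd_dmult_commuting)
    moreover have "B \<star> (Q \<star> Q) \<star> W = B \<star> (W \<star> (Q \<star> Q))"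
      by (metis dmult_assoc WQ)
    moreover have "rdvd P (B \<star> (- smult c Q - W \<star> (Q \<star> Q)))" using T by (rule rdvd_dmult)
    moreover have "B \<star> (- smult c Q - W \<star> (Q \<star> Q)) = - smult c (B \<star> Q) - B \<star> (W \<star> (Q \<star> Q))"
      unfolding c_def by (simp add: dmult_diff_right dmult_minus_right dmult_smult_cst_right)
    ultimately have "rdvd P (- smult c (B \<star> Q))" using rdvd_add by fastforce
    then have "rdvd P (smult (- (1 / c)) (- smult c (B \<star> Q)))" by (rule rdvd_smult)
    then have "rdvd P (B \<star> Q)" using c by simp
    then show ?thesis unfolding A B_def by (intro rdvd_add rdvd_dmult[OF rdvd_refl])
  qed
  obtain \<kappa> \<chi> where \<kappa>: "\<kappa> \<noteq> 0"
    "\<And>t. dres P (dshift Q t) = \<kappa> * cst t ^ degree G * poly \<chi> (cst t)" "poly \<chi> 0 \<noteq> 0"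
    using dres_eq_power_char_poly[OF G] P Q degL degM inj by metis
  \<comment> \<open>\<open>w\<close> is \<open>h(x, y + t)\<close> as a polynomial in
    \<open>t\<close>; its root 0 is simple.\<close>
  define w where "w = map_poly (\<lambda>p. poly p x) h \<circ>\<^sub>p [:y, 1:]"
  have pw: "poly w t = eval2 h x (y + t)" for t
    by (simp add: w_def poly_pcompose eval2_def)
  have "poly w 0 = 0" using h0 by (simp add: pw)
  then obtain u where u: "w = pCons 0 u" by (cases w) auto
  have "poly (pderiv w) 0 = eval2 (dmu h) x y"
    by (simp add: w_def pderiv_pcompose poly_pcompose eval2_dmu pderiv_pCons)
  then have u0: "poly u 0 \<noteq> 0" using h1 by (simp add: u pderiv_pCons)
  define U where "U = smult \<epsilon> (map_poly cst (u ^ s))"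
  have "poly U 0 \<noteq> 0"
    using u0 eps poly_map_cst[of "u ^ s" 0] by (simp add: U_def)
  \<comment> \<open>Both sides are the resultant in \<open>t\<close>; comparing the orders of
    vanishing at 0 gives the claim.\<close>
  moreover have "monom 1 (degree G) * smult \<kappa> \<chi> = monom 1 s * U"
  proof (rule poly_eqI_on_cst)
    fix t
    have "dshift Q t = dshift M (y + t)" by (simp add: Q_def dshift_def)
    then have "\<kappa> * cst t ^ degree G * poly \<chi> (cst t) = \<epsilon> * cst (eval2 h x (y + t) ^ s)"
      using \<kappa>(2)[of t] res[of x "y + t"] by (simp add: P_def)
    also have "eval2 h x (y + t) = t * poly u t" by (simp add: pw[symmetric] u)
    finally show "poly (monom 1 (degree G) * smult \<kappa> \<chi>) (cst t) = poly (monom 1 s * U) (cst t)"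
      by (simp add: U_def poly_monom poly_map_cst power_mult_distrib mult.assoc mult.left_commute)
  qed
  moreover have "poly (smult \<kappa> \<chi>) 0 \<noteq> 0" using \<kappa> by simp
  ultimately show ?thesis
  proof -
    assume a: "poly U 0 \<noteq> 0" "monom 1 (degree G) * smult \<kappa> \<chi> = monom 1 s * U" "poly (smult \<kappa> \<chi>) 0 \<noteq> 0"
    have "s \<le> degree G" if "a \<noteq> 0" "monom 1 (degree G) * A = monom 1 s * B" "coeff A 0 = a" for a :: rf and A B
      using arg_cong[OF that(2), of "\<lambda>p. coeff p (degree G)"] that(1,3)
      by (auto simp: coeff_monom_mult split: if_splits)
    moreover have "degree G \<le> s" if "a \<noteq> 0" "monom 1 (degree G) * A = monom 1 s * B" "coeff B 0 = a" for a :: rf and A B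
      using arg_cong[OF that(2), of "\<lambda>p. coeff p s"] that(1,3)
      by (auto simp: coeff_monom_mult split: if_splits)
    ultimately show ?thesis using a unfolding poly_0_coeff_0 by (metis antisym)
  qed
qed

end

subsection \<open>The exponent equals the rank\<close>

lemma dalg_commute:
  assumes comm: "L \<star> M = M \<star> L" and A: "A \<in> dalg L M"
  shows "A \<star> L = L \<star> A"
  using A
proof induction
  case (mult A B)
  then show ?case by (metis dmult_assoc)
qed (simp_all add: comm dmult_add_left dmult_add_right)

lemma dpower_in_dalg: "A \<in> dalg L M \<Longrightarrow> dpower A i \<in> dalg L M"
proof (induction i)
  case 0
  show ?case using dalg.const[of 1 L M] by (simp add: one_pCons)
qed (auto intro: dalg.mult)

lemma degree_dpower: "A \<noteq> 0 \<Longrightarrow> dpower A i \<noteq> 0 \<and> degree (dpower A i) = i * degree A"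
  by (induction i) (auto simp: degree_dmult)

lemma cst_sum: "cst (\<Sum>i\<in>I. f i) = (\<Sum>i\<in>I. cst (f i))"
  by (induction I rule: infinite_finite_induct) auto

text \<open>Gaussian elimination over the constants: operators of equal order commuting with \<open>L\<close> have
  leading coefficients that are constant multiples of each other.\<close>
lemma commuting_dependence:
  fixes X :: "'i \<Rightarrow> dop"
  assumes L: "degree L > 0"
    and S_comm: "\<And>A. A \<in> S \<Longrightarrow> A \<star> L = L \<star> A"
    and S_deg: "\<And>A. A \<in> S \<Longrightarrow> A \<noteq> 0 \<Longrightarrow> r dvd degree A"
    and S_lin: "\<And>A B c. A \<in> S \<Longrightarrow> B \<in> S \<Longrightarrow> A + smult (cst c) B \<in> S"
    and "finite I" "\<And>i. i \<in> I \<Longrightarrow> X i \<in> S"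
    and "\<And>i j. i \<in> I \<Longrightarrow> b \<le> j \<Longrightarrow> coeff (X i) j = 0"
    and "card {k. k < b \<and> r dvd k} < card I"
  shows "\<exists>c. (\<exists>i\<in>I. c i \<noteq> 0) \<and> (\<Sum>i\<in>I. smult (cst (c i)) (X i)) = 0"
  using assms(5-)
proof (induction b arbitrary: I X)
  case 0
  then obtain i where "i \<in> I" by fastforce
  moreover have "X i = 0" if "i \<in> I" for i using 0(3)[OF that] by (intro poly_eqI) simp
  ultimately show ?case by (intro exI[of _ "\<lambda>_. 1"]) auto
next
  case (Suc b)
  have fin: "finite {k. k < b \<and> r dvd k}" by simp
  show ?case
  proof (cases "\<forall>i\<in>I. coeff (X i) b = 0")
    case True
    have "card {k. k < b \<and> r dvd k} \<le> card {k. k < Suc b \<and> r dvd k}"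
      by (intro card_mono) auto
    then have lt: "card {k. k < b \<and> r dvd k} < card I" using Suc.prems(4) by simp
    show ?thesis
    proof (rule Suc.IH[OF Suc.prems(1,2) _ lt])
      show "coeff (X i) j = 0" if "i \<in> I" "b \<le> j" for i j
        using True Suc.prems(3)[of i j] that by (cases "j = b") auto
    qed
  next
    case False
    then obtain k where k: "k \<in> I" "coeff (X k) b \<noteq> 0" by blast
    have top: "degree (X i) = b" "X i \<noteq> 0" if "i \<in> I" "coeff (X i) b \<noteq> 0" for i
    proof -
      show "degree (X i) = b"
        using that(2) Suc.prems(3)[OF that(1)] by (intro antisym degree_le le_degree) auto
      show "X i \<noteq> 0" using that(2) by auto
    qed
    \<comment> \<open>So \<open>b\<close> is one of the counted multiples, and dropping
      \<open>X k\<close> along with it preserves the inequality of cardinalities.\<close>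
    have rb: "r dvd b" using S_deg[OF Suc.prems(2)[OF k(1)] top(2)[OF k]] top(1)[OF k] by simp
    have "\<exists>e. coeff (X i) b = cst e * coeff (X k) b" if i: "i \<in> I" for i
    proof (cases "coeff (X i) b = 0")
      case True
      then show ?thesis by (intro exI[of _ 0]) simp
    next
      case False
      obtain e where "lead_coeff (X i) = cst e * lead_coeff (X k)"
        by (rule lead_coeff_commuting_proportional[of "X i" L "X k"])
           (use top[OF i False] top[OF k] S_comm Suc.prems(2) i k(1) L in auto)
      then show ?thesis using top[OF i False] top[OF k] by auto
    qed
    then obtain e where e: "\<And>i. i \<in> I \<Longrightarrow> coeff (X i) b = cst (e i) * coeff (X k) b" by metis
    define Y where "Y = (\<lambda>i. X i + smult (cst (- e i)) (X k))"
    have "\<exists>c. (\<exists>i\<in>I - {k}. c i \<noteq> 0) \<and> (\<Sum>i\<in>I - {k}. smult (cst (c i)) (Y i)) = 0"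
    proof (rule Suc.IH)
      show "finite (I - {k})" using Suc.prems by simp
      show "Y i \<in> S" if "i \<in> I - {k}" for i
        using that Suc.prems(2) k unfolding Y_def by (intro S_lin) auto
      show "coeff (Y i) j = 0" if "i \<in> I - {k}" "b \<le> j" for i j
        using that Suc.prems(3)[of i j] Suc.prems(3)[of k j] k e[of i]
        by (cases "j = b") (auto simp: Y_def)
      have "{j. j < Suc b \<and> r dvd j} = insert b {j. j < b \<and> r dvd j}" using rb by auto
      then have "card {j. j < Suc b \<and> r dvd j} = Suc (card {j. j < b \<and> r dvd j})" by simp
      then show "card {j. j < b \<and> r dvd j} < card (I - {k})"
        using Suc.prems(1,4) k by simp
    qed
    then obtain c where c: "\<exists>i\<in>I - {k}. c i \<noteq> 0" "(\<Sum>i\<in>I - {k}. smult (cst (c i)) (Y i)) = 0" by blast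
    \<comment> \<open>The weight of \<open>X k\<close> collects what each \<open>Y i\<close>
      subtracted.\<close>
    define c' where "c' = c(k := - (\<Sum>i\<in>I - {k}. c i * e i))"
    have "(\<Sum>i\<in>I. smult (cst (c' i)) (X i))
       = smult (cst (c' k)) (X k) + (\<Sum>i\<in>I - {k}. smult (cst (c' i)) (X i))"
      using Suc.prems(1) k(1) by (rule sum.remove)
    also have "(\<Sum>i\<in>I - {k}. smult (cst (c' i)) (X i)) = (\<Sum>i\<in>I - {k}. smult (cst (c i)) (X i))"
      by (intro sum.cong) (auto simp: c'_def)
    also have "smult (cst (c' k)) (X k) = (\<Sum>i\<in>I - {k}. smult (- cst (c i) * cst (e i)) (X k))"
      by (simp add: c'_def cst_sum smult_sum sum_negf)
    also have "\<dots> + (\<Sum>i\<in>I - {k}. smult (cst (c i)) (X i)) = (\<Sum>i\<in>I - {k}. smult (cst (c i)) (Y i))"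
      by (simp add: Y_def smult_diff_right sum_subtractf sum_negf)
    finally have "(\<Sum>i\<in>I. smult (cst (c' i)) (X i)) = 0" using c(2) by simp
    moreover have "\<exists>i\<in>I. c' i \<noteq> 0" using c(1) by (auto simp: c'_def)
    ultimately show ?thesis by blast
  qed
qed

lemma eval2_monom [simp]: "eval2 (monom (monom c i) j) x y = c * x ^ i * y ^ j"
  by (simp add: eval2_def map_poly_monom poly_monom)

lemma eval2_sum: "eval2 (\<Sum>a\<in>I. f a) x y = (\<Sum>a\<in>I. eval2 (f a) x y)"
  by (induction I rule: infinite_finite_induct) auto

context spectral_resultant
begin

text \<open>Modulo a common right factor of \<open>L - x\<close> and \<open>M - y\<close> the
  monomials become \<open>x^i y^j\<close>; the relation leaves a constant divisible by a factor of
  positive order.\<close>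

lemma monomial_relation_on_curve:
  assumes rel: "(\<Sum>a\<in>I. smult (cst (c a)) (dpower L (i a) \<star> dpower M (j a))) = 0"
    and pt: "eval2 h x y = 0"
  shows "(\<Sum>a\<in>I. c a * x ^ i a * y ^ j a) = 0"
proof -
  obtain G where G: "degree G > 0" "rdvd G (dshift L x)" "rdvd G (dshift M y)"
    using pt by (rule common_right_factor)
  have 1: "rdvd G (dpower L p \<star> dpower M q - [:cst (x ^ p * y ^ q):])" for p q
  proof -
    have "dpower L p \<star> dpower M q - [:cst (x ^ p * y ^ q):]
      = dpower L p \<star> (dpower M q - [:cst (y ^ q):]) + smult (cst (y ^ q)) (dpower L p - [:cst (x ^ p):])"
      by (simp add: dmult_diff_right smult_diff_right mult.commute del: cst_power)
    then show ?thesis using rdvd_dpower_diff[OF G(2)] rdvd_dpower_diff[OF G(3)]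
      by (auto intro!: rdvd_add rdvd_dmult rdvd_smult)
  qed
  have "[:cst (\<Sum>a\<in>I. c a * x ^ i a * y ^ j a):] = (\<Sum>a\<in>I. smult (cst (c a)) [:cst (x ^ i a * y ^ j a):])"
    by (intro poly_eqI) (simp add: coeff_sum coeff_pCons cst_sum mult.assoc split: nat.split)
  also have "\<dots> = (\<Sum>a\<in>I. smult (cst (c a)) (dpower L (i a) \<star> dpower M (j a)))
     - (\<Sum>a\<in>I. smult (cst (c a)) (dpower L (i a) \<star> dpower M (j a) - [:cst (x ^ i a * y ^ j a):]))"
    by (simp only: smult_diff_right sum_subtractf) simp
  also have "rdvd G \<dots>" unfolding rel by (intro rdvd_diff rdvd_0 rdvd_sum rdvd_smult 1)
  finally have "rdvd G [:cst (\<Sum>a\<in>I. c a * x ^ i a * y ^ j a):]" .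
  then show ?thesis
    using rdvd_degree_le[of G "[:cst (\<Sum>a\<in>I. c a * x ^ i a * y ^ j a):]"] G(1) by fastforce
qed

text \<open>An elementary form of the Nullstellensatz for degrees in mu: pseudo-division of
  \<open>h\<close> by a vanishing \<open>g0\<close> of least degree leaves remainder zero, and
  primality of \<open>h\<close> then gives \<open>h dvd g0\<close>.\<close>

lemma degree_le_if_vanishing_on_curve:
  assumes irr: "irreducible h" and g: "g \<noteq> 0" "\<And>x y. eval2 h x y = 0 \<Longrightarrow> eval2 g x y = 0"
  shows "degree h \<le> degree g"
proof -
  define V where "V = (\<lambda>g. g \<noteq> 0 \<and> (\<forall>x y. eval2 h x y = 0 \<longrightarrow> eval2 g x y = 0))"
  have "V g" using g by (auto simp: V_def)
  define g0 where "g0 = arg_min degree V"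
  have g0: "V g0" and min: "\<And>p. V p \<Longrightarrow> degree g0 \<le> degree p"
    using arg_min_natI[of V g degree] arg_min_nat_le[of V _ degree] \<open>V g\<close> by (auto simp: g0_def)
  have g00: "g0 \<noteq> 0" using g0 by (simp add: V_def)
  \<comment> \<open>A polynomial in lambda alone would vanish everywhere, as every \<open>x\<close>
    has a point over it.\<close>
  have pos: "degree g0 \<noteq> 0"
  proof
    assume "degree g0 = 0"
    then obtain a where a: "g0 = [:a:]" by (rule degree_eq_zeroE)
    have "poly a x = 0" for x
    proof -
      obtain y where "eval2 h x y = 0" by (rule point_over)
      then show ?thesis using g0 by (auto simp: V_def a)
    qed
    then have "a = 0" using poly_all_0_iff_0 by blast
    then show False using g00 a by simp
  qed
  obtain a q where aq: "a \<noteq> 0" "smult a h = g0 * q + pseudo_mod h g0"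
    using pseudo_mod(1)[OF g00, of h] by blast
  have "\<not> V (pseudo_mod h g0)"
  proof
    assume v: "V (pseudo_mod h g0)"
    then have "pseudo_mod h g0 \<noteq> 0" by (simp add: V_def)
    then have "degree (pseudo_mod h g0) < degree g0" using pseudo_mod(2)[OF g00, of h] by simp
    then show False using min[OF v] by simp
  qed
  moreover have "eval2 (pseudo_mod h g0) x y = 0" if "eval2 h x y = 0" for x y
    using arg_cong[OF aq(2), of "\<lambda>p. eval2 p x y"] that g0 by (auto simp: V_def)
  ultimately have "pseudo_mod h g0 = 0" unfolding V_def by blast
  then have eq: "smult a h = g0 * q" using aq by simp
  have prime: "prime_elem h" using irr by (rule irreducible_imp_prime_elem)
  have "h dvd g0 * q" unfolding eq[symmetric] by (rule dvd_smult) simp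
  then have "h dvd g0 \<or> h dvd q" using prime by (simp add: prime_elem_dvd_mult_iff)
  then have "h dvd g0"
  proof
    \<comment> \<open>Then \<open>g0\<close> would divide \<open>a\<close>, which has degree 0 in
      mu.\<close>
    assume "h dvd q"
    then obtain p where p: "q = h * p" ..
    have h0: "h \<noteq> 0" using irr by auto
    have "h * [:a:] = h * (g0 * p)" using eq by (simp add: p algebra_simps)
    then have "[:a:] = g0 * p" using h0 by (simp only: mult_cancel_left) simp
    moreover from this have "p \<noteq> 0" using aq(1) by auto
    ultimately have "degree g0 + degree p = 0" using degree_mult_eq[OF g00, of p] by (metis degree_pCons_0)
    then show ?thesis using pos by simp
  qed
  then have "degree h \<le> degree g0" using g00 by (rule dvd_imp_degree_le)
  also have "\<dots> \<le> degree g" using \<open>V g\<close> by (rule min)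
  finally show ?thesis .
qed

text \<open>Among the monomials \<open>L\<^sup>i M\<^sup>j\<close> with \<open>j \<le> n / r\<close> there are more of bounded order than multiples
  of \<open>r\<close>, so a polynomial of degree at most \<open>n / r\<close> in the second variable vanishes on the curve.\<close>
lemma rank_le_exponent:
  assumes irr: "irreducible h" and r: "r = gcd (degree L) (degree M)"
    and rank: "\<And>A. A \<in> dalg L M \<Longrightarrow> A \<noteq> 0 \<Longrightarrow> r dvd degree A"
  shows "r \<le> s"
proof -
  obtain n' where n': "degree L = r * n'" using r by (metis dvdE gcd_dvd1)
  obtain m' where m': "degree M = r * m'" using r by (metis dvdE gcd_dvd2)
  have L0: "L \<noteq> 0" and M0: "M \<noteq> 0" using degL degM by auto
  have rpos: "r > 0" "n' > 0" using n' degL by (auto intro: Nat.gr0I)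
  define q where "q = Suc n'"
  \<comment> \<open>The \<open>N * (n' + 1)\<close> monomials have orders among the
    \<open>K + 1\<close> multiples of \<open>r\<close> up to \<open>r * K\<close>; this
    \<open>N\<close> leaves a surplus of \<open>n' + 1\<close>.\<close>
  define N where "N = n' * m' + 2"
  define K where "K = (N - 1) * n' + n' * m'"
  \<comment> \<open>The index \<open>a\<close> encodes the exponent pair by quotient and remainder
    modulo \<open>q\<close>.\<close>
  define X where "X = (\<lambda>a. dpower L (a div q) \<star> dpower M (a mod q))"
  have q: "q > 0" by (simp add: q_def)
  have X0: "X a \<noteq> 0 \<and> degree (X a) = (a div q) * degree L + (a mod q) * degree M" for a
    using degree_dpower[OF L0, of "a div q"] degree_dpower[OF M0, of "a mod q"]
    by (auto simp: X_def degree_dmult)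
  have Xdeg: "degree (X a) \<le> r * K" if "a < N * q" for a
  proof -
    have "a div q < N" using that by (rule less_mult_imp_div_less)
    then have "a div q \<le> N - 1" by simp
    moreover have "a mod q \<le> n'" using mod_less_divisor[OF q, of a] by (simp add: q_def)
    ultimately have "(a div q) * (r * n') + (a mod q) * (r * m') \<le> (N - 1) * (r * n') + n' * (r * m')"
      by (intro add_mono mult_right_mono) auto
    also have "\<dots> = r * K" by (simp add: K_def algebra_simps)
    finally show ?thesis using X0[of a] by (simp add: n' m')
  qed
  have "\<exists>c. (\<exists>a\<in>{..<N * q}. c a \<noteq> 0) \<and> (\<Sum>a\<in>{..<N * q}. smult (cst (c a)) (X a)) = 0"
  proof (rule commuting_dependence[OF degL, where S = "dalg L M" and r = r and b = "r * K + 1"])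
    show "A \<star> L = L \<star> A" if "A \<in> dalg L M" for A using comm that by (rule dalg_commute)
    show "r dvd degree A" if "A \<in> dalg L M" "A \<noteq> 0" for A using that by (rule rank)
    show "A + smult (cst c) B \<in> dalg L M" if "A \<in> dalg L M" "B \<in> dalg L M" for A B c
      using dalg.add[OF that(1) dalg.mult[OF dalg.const that(2), of c]] by simp
    show "X a \<in> dalg L M" for a
      unfolding X_def by (intro dalg.mult dpower_in_dalg dalg.genL dalg.genM)
    show "coeff (X a) j = 0" if "a \<in> {..<N * q}" "r * K + 1 \<le> j" for a j
      using Xdeg[of a] that by (intro coeff_eq_0) auto
    have "{k. k < r * K + 1 \<and> r dvd k} \<subseteq> (\<lambda>k. r * k) ` {..K}"
      using rpos by (auto simp: dvd_def less_Suc_eq_le)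
    then have "card {k. k < r * K + 1 \<and> r dvd k} \<le> card ((\<lambda>k. r * k) ` {..K})"
      by (intro card_mono) auto
    also have "\<dots> \<le> K + 1" using card_image_le[of "{..K}" "\<lambda>k. r * k"] by simp
    also have "\<dots> < N * q" by (simp add: K_def N_def q_def algebra_simps)
    finally show "card {k. k < r * K + 1 \<and> r dvd k} < card {..<N * q}" by simp
  qed simp
  then obtain c where c: "\<exists>a<N * q. c a \<noteq> 0" and rel: "(\<Sum>a<N * q. smult (cst (c a)) (X a)) = 0"
    by blast
  define g where "g = (\<Sum>a<N * q. monom (monom (c a) (a div q)) (a mod q))"
  obtain b where b: "b < N * q" "c b \<noteq> 0" using c by blast
  \<comment> \<open>Distinct indices encode distinct exponent pairs, so nothing cancels.\<close>
  have "coeff (coeff g (b mod q)) (b div q) = (\<Sum>a<N * q. if a = b then c b else 0)"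
  proof -
    have "a mod q = b mod q \<and> a div q = b div q \<longleftrightarrow> a = b" for a
      by (metis div_mult_mod_eq)
    then show ?thesis unfolding g_def coeff_sum
      by (intro sum.cong) (auto simp: coeff_monom)
  qed
  then have "coeff (coeff g (b mod q)) (b div q) \<noteq> 0" using b by simp
  then have "g \<noteq> 0" by auto
  moreover have "eval2 g x y = 0" if "eval2 h x y = 0" for x y
    unfolding g_def eval2_sum eval2_monom
    using rel that unfolding X_def by (rule monomial_relation_on_curve)
  ultimately have "degree h \<le> degree g" using irr by (intro degree_le_if_vanishing_on_curve)
  also have "degree g \<le> n'"
    unfolding g_def
  proof (intro degree_sum_le)
    fix a
    have "degree (monom (monom (c a) (a div q)) (a mod q)) \<le> a mod q" by (rule degree_monom_le)
    also have "\<dots> \<le> n'" using mod_less_divisor[OF q, of a] by (simp add: q_def)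
    finally show "degree (monom (monom (c a) (a div q)) (a mod q)) \<le> n'" .
  qed simp
  finally have "degree h \<le> n'" .
  \<comment> \<open>The fibre over 0 turns the bound on \<open>degree h\<close> into one on
    \<open>s\<close>.\<close>
  have "r * n' = s * degree (map_poly (\<lambda>p. poly p 0) h)" using degree_fiber[of 0] n' by simp
  also have "\<dots> \<le> s * n'"
    using degree_map_poly_le[of "\<lambda>p. poly p 0" h] \<open>degree h \<le> n'\<close> by (intro mult_left_mono) auto
  finally show ?thesis using rpos by simp
qed

end

section \<open>Exponent and rank agree, and the order of the divisor at a non-singular point\<close>

theorem mainTheorem2:
  fixes L M :: dop and r :: nat and h :: "complex poly poly" and lam0 mu0 :: complex
  assumes commute: "dmult L M = dmult M L"
    and ordL: "dord L > 0" and ordM: "dord M > 0"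
    and truerank: "true_rank_pair L M r"
    and curve: "spectral_poly L M h"
    and nonsing: "nonsingular_point h lam0 mu0"
  shows "(\<forall>k<r. dsubres (dshift L lam0) (dshift M mu0) k = 0)
       \<and> (r < min (dord L) (dord M) \<longrightarrow>
            dord (dsubres (dshift L lam0) (dshift M mu0) r) = r
          \<and> is_gcrd (dsubres (dshift L lam0) (dshift M mu0) r) (dshift L lam0) (dshift M mu0))"
proof -
  have degL: "degree L > 0" and degM: "degree M > 0" using ordL ordM by (simp_all add: dord_def)
  obtain s where irr: "irreducible h"
    and res: "\<And>x y. dres (dshift L x) (dshift M y) = cst (eval2 h x y ^ s)"
    using curve unfolding spectral_poly_def by blast
  interpret orig: spectral_resultant L M h s 1
    by unfold_locales (use commute degL degM res in auto)
  obtain h' where h': "\<And>x y. eval2 h' y x = eval2 h x y" "\<And>x y. eval2 (dmu h') y x = eval2 (dlam h) x y"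
    using swap_variables by blast
  obtain \<epsilon> where \<epsilon>: "\<epsilon> \<noteq> 0"
    "\<And>P Q. degree P = degree L \<Longrightarrow> degree Q = degree M \<Longrightarrow> dres Q P = \<epsilon> * dres P Q"
    using dres_swap by blast
  \<comment> \<open>The exchanged pair gives the fibre degrees over the other coordinate and the
    case of a nonzero lambda-derivative.\<close>
  interpret swapped: spectral_resultant M L h' s \<epsilon>
    by unfold_locales (use commute degL degM res h' \<epsilon> degree_dshift in auto)
  have r: "r = gcd (degree L) (degree M)" and rank: "r = op_rank (dalg L M)"
    using truerank by (simp_all add: true_rank_pair_def dord_def)
  have "r dvd degree A" if "A \<in> dalg L M" "A \<noteq> 0" for A
    unfolding rank op_rank_def using that by (intro Gcd_dvd) (auto simp: dord_def)
  then have "r \<le> s" using orig.rank_le_exponent[OF irr r] by blast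
  moreover have "s \<le> r"
  proof (rule dvd_imp_le)
    show "s dvd r" unfolding r
      using orig.degree_fiber[of 0] swapped.degree_fiber[of 0] by (metis dvd_triv_left gcd_greatest)
    show "r > 0" using degL by (simp add: r)
  qed
  ultimately have sr: "s = r" by simp
  define P where "P = dshift L lam0"
  define Q where "Q = dshift M mu0"
  have P: "degree P = degree L" and Q: "degree Q = degree M"
    using degree_dshift degL degM by (simp_all add: P_def Q_def)
  have P0: "P \<noteq> 0" and Q0: "Q \<noteq> 0" using P Q degL degM by auto
  obtain G where G: "bezout_gcrd G P Q" using P0 by (rule bezout_gcrd_exists)
  have h0: "eval2 h lam0 mu0 = 0" and h1: "eval2 (dlam h) lam0 mu0 \<noteq> 0 \<or> eval2 (dmu h) lam0 mu0 \<noteq> 0"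
    using nonsing by (simp_all add: nonsingular_point_def)
  have Gr: "degree G = r"
    using h1
  proof
    assume "eval2 (dmu h) lam0 mu0 \<noteq> 0"
    then show ?thesis using orig.degree_gcrd_if_dmu_nonzero[OF h0] G sr by (simp add: P_def Q_def)
  next
    assume "eval2 (dlam h) lam0 mu0 \<noteq> 0"
    then show ?thesis
      using swapped.degree_gcrd_if_dmu_nonzero[of mu0 lam0 G] h0 h' G sr bezout_gcrd_commute
      by (simp add: P_def Q_def)
  qed
  have "dsubres P Q k = 0" if "k < r" for k
    using dsubres_eq_0[OF G P0 Q0] that Gr by simp
  \<comment> \<open>The strict bound is the range of indices in which subresultants are
    defined.\<close>
  moreover have "dord (dsubres P Q r) = r \<and> is_gcrd (dsubres P Q r) P Q" if lt: "r < min (dord L) (dord M)"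
  proof -
    obtain c where c: "c \<noteq> 0" "dsubres P Q (degree G) = smult c G"
      by (rule dsubres_gcrd[OF G]) (use lt in \<open>simp_all add: Gr P Q dord_def\<close>)
    then show ?thesis using bezout_gcrd_imp_is_gcrd[OF G c(1)] by (simp add: Gr dord_def)
  qed
  ultimately show ?thesis unfolding P_def Q_def by blast
qed

end
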